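(* Let $p\in\mathbb{R}$, $p\ge2$, let $\beta>1-\frac{1}{2p+4}$, and let $\phi:[0,\infty)\to\mathbb{R}$ be a $(p,\beta)$-function. Let $\mu$ be the limiting distribution of $\phi$ (which exists since $p\ge2$ and $\beta>1/2$). Then for every integer $n$ with $1\le n\le p$ the moments of order $n$ of $\phi$ and of $\mu$ coincide, i.e. $$\lim_{Y\to\infty}\frac1Y\int_0^Y\phi(y)^n\,dy=\int_{\mathbb{R}}x^n\,d\mu(x)$$ (in particular the limit on the left exists).
   Context: Let $p\in\mathbb{R}$, $p\ge 1$. A (Lebesgue measurable) function $\phi:[0,\infty)\to\mathbb{R}$ is called a $p$-function if there exist a strictly increasing sequence $\{\lambda_n\}_{n\ge1}$ of positive real numbers tending to infinity, a sequence $\{r_n\}_{n\ge1}$ of complex numbers, and numbers $y_0,X_0>0$ such that $\phi\in L^p([0,y_0])$ and, for all $y\ge y_0$ and $X\ge X_0$, $$\phi(y)=2\Re\Big(\sum_{0<\lambda_n\le X}r_ne^{i\lambda_ny}\Big)+\mathcal{E}(y,X),$$ where $\mathcal{E}(y,X)$ satisfies $$\lim_{Y\to\infty}\frac1Y\int_{y_0}^Y|\mathcal{E}(y,X(Y))|^p\,dy=0$$ for some non-decreasing function $X(Y)$ tending to infinity as $Y\to\infty$. If moreover there is $\beta\in\mathbb{R}$ such that $\sum_{T\le\lambda_n\le T+1}|r_n|\ll T^{-\beta}$ for $T\gg1$ (i.e. there are constants $C,T_0>0$ with $\sum_{T\le\lambda_n\le T+1}|r_n|\le CT^{-\beta}$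 for all $T\ge T_0$), then $\phi$ is called a $(p,\beta)$-function. A limiting distribution for a function $\phi:[0,\infty)\to\mathbb{R}$ is a probability measure $\mu$ on $\mathbb{R}$ such that $$\lim_{Y\to\infty}\frac1Y\int_0^Yg(\phi(y))\,dy=\int_{\mathbb{R}}g\,d\mu$$ for every bounded continuous function $g$ on $\mathbb{R}$. *)

theory Defs
  imports "HOL-Probability.Probability"
begin

text \<open>
  Functions on \<open>[0,\<infinity>)\<close> are total functions \<open>real \<Rightarrow> real\<close> of which only the
  restriction to \<open>{0..}\<close> is ever used. The sequences are indexed from \<open>0\<close> instead of \<open>1\<close>.
  The Bochner integral of a non-integrable function is \<open>0\<close>, hence the explicit
  integrability condition next to the mean value of the error term.
  The existence of \<open>E\<close> only names the difference of the two sides: its values at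
  \<open>X < X0\<close> do not matter, because \<open>XX Y \<ge> X0\<close> for all large \<open>Y\<close>.
\<close>

definition p_function_with ::
  "real \<Rightarrow> (real \<Rightarrow> real) \<Rightarrow> (nat \<Rightarrow> real) \<Rightarrow> (nat \<Rightarrow> complex) \<Rightarrow> bool"
where
  "p_function_with p \<phi> lam r \<longleftrightarrow>
     1 \<le> p \<and>
     set_borel_measurable lebesgue {0..} \<phi> \<and>
     strict_mono lam \<and> (\<forall>n. 0 < lam n) \<and> filterlim lam at_top sequentially \<and>
     (\<exists>y0 > 0. \<exists>X0 > 0.
        set_integrable lebesgue {0..y0} (\<lambda>y. \<bar>\<phi> y\<bar> powr p) \<and>
        (\<exists>E :: real \<Rightarrow> real \<Rightarrow> real.
           (\<forall>y \<ge> y0. \<forall>X \<ge> X0.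
              \<phi> y = 2 * Re (\<Sum>n | 0 < lam n \<and> lam n \<le> X.
                                r n * exp (\<i> * complex_of_real (lam n * y))) + E y X) \<and>
           (\<exists>XX :: real \<Rightarrow> real.
              mono_on {y0..} XX \<and> filterlim XX at_top at_top \<and>
              (\<forall>\<^sub>F Y in at_top. set_integrable lebesgue {y0..Y} (\<lambda>y. \<bar>E y (XX Y)\<bar> powr p)) \<and>
              ((\<lambda>Y. 1 / Y * (LINT y:{y0..Y}|lebesgue. \<bar>E y (XX Y)\<bar> powr p)) \<longlongrightarrow> 0) at_top)))"

definition p_function :: "real \<Rightarrow> (real \<Rightarrow> real) \<Rightarrow> bool" where
  "p_function p \<phi> \<longleftrightarrow> (\<exists>lam r. p_function_with p \<phi> lam r)"

definition p_beta_function :: "real \<Rightarrow> real \<Rightarrow> (real \<Rightarrow> real) \<Rightarrow> bool" where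
  "p_beta_function p \<beta> \<phi> \<longleftrightarrow>
     (\<exists>lam r. p_function_with p \<phi> lam r \<and>
        (\<exists>C > 0. \<exists>T0 > 0. \<forall>T \<ge> T0.
           (\<Sum>n | T \<le> lam n \<and> lam n \<le> T + 1. cmod (r n)) \<le> C * T powr (- \<beta>)))"

definition limiting_distribution :: "(real \<Rightarrow> real) \<Rightarrow> real measure \<Rightarrow> bool" where
  "limiting_distribution \<phi> \<mu> \<longleftrightarrow>
     real_distribution \<mu> \<and>
     (\<forall>g :: real \<Rightarrow> real. continuous_on UNIV g \<and> bounded (range g) \<longrightarrow>
        ((\<lambda>Y. 1 / Y * (LINT y:{0..Y}|lebesgue. g (\<phi> y))) \<longlongrightarrow> (LINT x|\<mu>. g x)) at_top)"

end

theory Submission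
  imports Defs
begin

text \<open>
  On a dyadic block \<open>2^j < \<lambda>\<^sub>n \<le> 2^(j+1)\<close> the exponential sum is at most of order
  \<open>2^(j(1-\<beta>))\<close>, while comparison of the interval \<open>[0,Y]\<close> with a Gaussian of scale \<open>Y \<ge> 1\<close>, whose
  characteristic function is positive and rapidly decreasing, bounds its mean square by
  a constant times \<open>2^(j(1-2\<beta>))\<close>. Interpolating, its mean \<open>p\<close>-th power is at most of order
  \<open>2^(-j\<theta>)\<close> with \<open>\<theta> = 1 - p(1-\<beta>) > 0\<close>, uniformly in \<open>Y\<close>. Summing over blocks, \<open>\<phi>\<close> is approximated
  by trigonometric polynomials in the mean of order \<open>p\<close> (it is Besicovitch \<open>B^p\<close> almost periodic).

  Hence the means of \<open>cos(t\<phi>)\<close> and \<open>sin(t\<phi>)\<close> converge, and tightness together with Levy's continuity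
  theorem gives the limiting distribution. If \<open>\<bar>P\<bar> \<le> D\<close> and \<open>\<bar>\<phi>\<bar> > 2D\<close> then
  \<open>\<bar>\<phi>\<bar> \<le> 2\<bar>\<phi> - P\<bar>\<close>, so the approximation also makes \<open>\<bar>\<phi>\<bar>^p\<close> uniformly integrable in mean, and moments
  up to order \<open>p\<close> pass to the limit.
\<close>

section \<open>Means of trigonometric polynomials\<close>

text \<open>The uniform law on \<open>[0, Y]\<close>, so that mean values become expectations and
  probabilistic limit theorems apply. It lives on the Lebesgue sets because \<open>\<phi>\<close> is
  only Lebesgue measurable. For \<open>Y \<le> 0\<close> it is the null measure.\<close>

definition unif :: "real \<Rightarrow> real measure" where
  "unif Y = density lebesgue (\<lambda>y. ennreal (indicator {0..Y} y / Y))"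

lemma sets_unif [simp, measurable_cong]: "sets (unif Y) = sets lebesgue"
  by (simp add: unif_def)

lemma space_unif [simp]: "space (unif Y) = UNIV"
  by (simp add: unif_def)

lemma borel_measurable_unif_density [measurable]:
  "(\<lambda>y. indicator {0..Y} y / Y :: real) \<in> borel_measurable lebesgue"
  by (intro borel_measurable_divide borel_measurable_indicator) auto

lemma integrable_unif:
  fixes f :: "real \<Rightarrow> 'a::{banach, second_countable_topology}"
  assumes "f \<in> borel_measurable lebesgue" "Y > 0"
  shows "integrable (unif Y) f \<longleftrightarrow> set_integrable lebesgue {0..Y} f"
proof -
  have "integrable (unif Y) f \<longleftrightarrow> integrable lebesgue (\<lambda>y. (indicator {0..Y} y / Y) *\<^sub>R f y)"
    unfolding unif_def using assms by (intro integrable_density) auto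
  also have "(\<lambda>y. (indicator {0..Y} y / Y) *\<^sub>R f y) = (\<lambda>y. (1/Y) *\<^sub>R (indicator {0..Y} y *\<^sub>R f y))"
    by auto
  also have "integrable lebesgue \<dots> \<longleftrightarrow> set_integrable lebesgue {0..Y} f"
  proof
    assume "integrable lebesgue (\<lambda>y. (1/Y) *\<^sub>R (indicator {0..Y} y *\<^sub>R f y))"
    from integrable_scaleR_right[OF this, of Y] show "set_integrable lebesgue {0..Y} f"
      using assms by (simp add: set_integrable_def)
  next
    assume "set_integrable lebesgue {0..Y} f"
    then show "integrable lebesgue (\<lambda>y. (1/Y) *\<^sub>R (indicator {0..Y} y *\<^sub>R f y))"
      unfolding set_integrable_def by (intro integrable_scaleR_right)
  qed
  finally show ?thesis .
qed

lemma integral_unif: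
  fixes f :: "real \<Rightarrow> 'a::{banach, second_countable_topology}"
  assumes "f \<in> borel_measurable lebesgue" "Y > 0"
  shows "integral\<^sup>L (unif Y) f = (1/Y) *\<^sub>R (LINT y:{0..Y}|lebesgue. f y)"
proof -
  have "integral\<^sup>L (unif Y) f = integral\<^sup>L lebesgue (\<lambda>y. (indicator {0..Y} y / Y) *\<^sub>R f y)"
    unfolding unif_def using assms by (intro integral_density) auto
  also have "(\<lambda>y. (indicator {0..Y} y / Y) *\<^sub>R f y) = (\<lambda>y. (1/Y) *\<^sub>R (indicator {0..Y} y *\<^sub>R f y))"
    by auto
  also have "integral\<^sup>L lebesgue \<dots> = (1/Y) *\<^sub>R (LINT y:{0..Y}|lebesgue. f y)"
    unfolding set_lebesgue_integral_def by (rule integral_scaleR_right)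
  finally show ?thesis .
qed

lemma prob_space_unif:
  assumes "Y > 0"
  shows "prob_space (unif Y)"
proof
  have "emeasure (unif Y) UNIV = (\<integral>\<^sup>+y. ennreal (1/Y) * indicator {0..Y} y \<partial>lebesgue)"
    unfolding unif_def using assms
    by (subst emeasure_density) (auto intro!: nn_integral_cong split: split_indicator)
  also have "\<dots> = ennreal (1/Y) * emeasure lebesgue {0..Y}"
    by (rule nn_integral_cmult_indicator) auto
  also have "\<dots> = 1"
    using assms by (simp flip: ennreal_mult)
  finally show "emeasure (unif Y) (space (unif Y)) = 1"
    by simp
qed

lemma borel_measurable_lebesgue_continuous:
  fixes f :: "real \<Rightarrow> 'a::topological_space"
  assumes "continuous_on UNIV f"
  shows "f \<in> borel_measurable lebesgue"
  using borel_measurable_continuous_onI[OF assms] by (simp add: measurable_completion)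

lemma integrable_unif_bounded:
  fixes f :: "real \<Rightarrow> 'a::{banach, second_countable_topology}"
  assumes "f \<in> borel_measurable lebesgue" "\<And>y. norm (f y) \<le> B" "Y > 0"
  shows "integrable (unif Y) f"
proof -
  interpret prob_space "unif Y" by (rule prob_space_unif) fact
  show ?thesis
    using assms by (intro integrable_const_bound[where B=B]) auto
qed

text \<open>Generated by monomials and sums, so that linear claims reduce to one frequency.
  Frequencies are arbitrary reals; real-valued polynomials enter through
  \<open>complex_of_real\<close>.\<close>

inductive trig_poly :: "(real \<Rightarrow> complex) \<Rightarrow> bool" where
  monomial: "trig_poly (\<lambda>y. c * iexp (l * y))"
| add: "trig_poly f \<Longrightarrow> trig_poly g \<Longrightarrow> trig_poly (\<lambda>y. f y + g y)"

lemma trig_poly_const: "trig_poly (\<lambda>y. c)"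
  using trig_poly.monomial[of c 0] by simp

lemma trig_poly_sum:
  assumes "finite A" "\<And>i. i \<in> A \<Longrightarrow> trig_poly (f i)"
  shows "trig_poly (\<lambda>y. \<Sum>i\<in>A. f i y)"
  using assms by (induction A rule: finite_induct) (auto intro: trig_poly_const trig_poly.add)

text \<open>Frequencies of monomials add. Closure under products is what allows an algebraic
  polynomial to be applied to a trigonometric one.\<close>

lemma trig_poly_mult:
  assumes "trig_poly f" "trig_poly g"
  shows "trig_poly (\<lambda>y. f y * g y)"
  using assms
proof (induction f)
  case (monomial c l)
  show ?case
    using monomial
  proof (induction g)
    case (monomial d k)
    show ?case
      using trig_poly.monomial[of "c * d" "l + k"] by (simp add: exp_add algebra_simps)
  next
    case (add f g)
    then show ?case
      using trig_poly.add by (simp add: distrib_left)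
  qed
next
  case (add f1 f2)
  then show ?case
    using trig_poly.add by (simp add: distrib_right)
qed

lemma trig_poly_continuous:
  assumes "trig_poly f"
  shows "continuous_on UNIV f"
  using assms by induction (auto intro!: continuous_intros)

lemma trig_poly_bounded:
  assumes "trig_poly f"
  obtains B where "\<And>y. norm (f y) \<le> B"
proof -
  have "\<exists>B. \<forall>y. norm (f y) \<le> B"
    using assms
  proof induction
    case (monomial c l)
    then show ?case
      by (auto simp: norm_mult)
  next
    case (add f g)
    then obtain B C where "\<forall>y. norm (f y) \<le> B" "\<forall>y. norm (g y) \<le> C"
      by blast
    then have "\<forall>y. norm (f y + g y) \<le> B + C"
      by (meson norm_triangle_mono)
    then show ?case ..
  qed
  with that show thesis by blast
qed

lemma integral_iexp_unif:
  assumes "Y > 0" "l \<noteq> 0"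
  shows "(\<integral>y. iexp (l * y) \<partial>unif Y) = (iexp (l * Y) - 1) / (\<i> * l * Y)"
proof -
  have "(\<integral>y. iexp (l * y) \<partial>unif Y) = (1/Y) *\<^sub>R (LINT y:{0..Y}|lebesgue. iexp (l * y))"
    using assms by (intro integral_unif borel_measurable_lebesgue_continuous continuous_intros)
  also have "(LINT y:{0..Y}|lebesgue. iexp (l * y)) = (LINT y:{0..Y}|lborel. iexp (l * y))"
    unfolding set_lebesgue_integral_def
    by (intro integral_completion borel_measurable_scaleR borel_measurable_indicator
        borel_measurable_continuous_onI continuous_intros) auto
  also have "\<dots> = iexp (l * Y) / (\<i> * l) - iexp (l * 0) / (\<i> * l)"
    unfolding set_lebesgue_integral_def
  proof (rule integral_FTC_Icc)
    fix x :: real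
    have "((\<lambda>z. exp (\<i> * of_real l * z) / (\<i> * of_real l)) has_field_derivative
        exp (\<i> * of_real l * of_real x)) (at (of_real x))"
      using assms by (auto intro!: derivative_eq_intros)
    from has_vector_derivative_real_field[OF this]
    show "((\<lambda>y. iexp (l * y) / (\<i> * l)) has_vector_derivative iexp (l * x)) (at x within {0..Y})"
      by (simp add: mult.assoc)
  qed (use assms in \<open>auto intro!: continuous_intros\<close>)
  finally show ?thesis
    using assms by (simp add: scaleR_conv_of_real diff_divide_distrib mult_ac)
qed

text \<open>A nonzero frequency \<open>l\<close> contributes O(1/(|l| Y)) and frequency zero its
  coefficient; sums follow by linearity.\<close>

lemma trig_poly_mean:
  assumes "trig_poly f"
  obtains m where "((\<lambda>Y. \<integral>y. f y \<partial>unif Y) \<longlongrightarrow> m) at_top"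
proof -
  have "\<exists>m. ((\<lambda>Y. \<integral>y. f y \<partial>unif Y) \<longlongrightarrow> m) at_top"
    using assms
  proof induction
    case (monomial c l)
    show ?case
    proof (cases "l = 0")
      case True
      have "\<forall>\<^sub>F Y in at_top. (\<integral>y. c * iexp (l * y) \<partial>unif Y) = c"
        using eventually_gt_at_top[of "0::real"]
      proof eventually_elim
        case (elim Y)
        interpret prob_space "unif Y" by (rule prob_space_unif) fact
        show ?case using True prob_space by simp
      qed
      then show ?thesis
        by (intro exI tendsto_eventually)
    next
      case False
      have "((\<lambda>Y. c * ((iexp (l * Y) - 1) / (\<i> * l * Y))) \<longlongrightarrow> 0) at_top"
      proof (rule Lim_null_comparison)
        have bound: "norm (iexp (l * Y) - 1) \<le> 2" for Y
          using norm_triangle_ineq4[of "iexp (l * Y)" 1] by simp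
        show "\<forall>\<^sub>F Y in at_top. norm (c * ((iexp (l * Y) - 1) / (\<i> * l * Y))) \<le> (norm c * 2 / \<bar>l\<bar>) / Y"
          using eventually_gt_at_top[of "0::real"]
        proof eventually_elim
          case (elim Y)
          have "norm (c * ((iexp (l * Y) - 1) / (\<i> * l * Y))) = norm c * norm (iexp (l * Y) - 1) / (\<bar>l\<bar> * Y)"
            using elim by (simp add: norm_mult norm_divide)
          also have "\<dots> \<le> norm c * 2 / (\<bar>l\<bar> * Y)"
            using elim bound by (intro divide_right_mono mult_left_mono) auto
          finally show ?case by simp
        qed
        show "((\<lambda>Y. (norm c * 2 / \<bar>l\<bar>) / Y) \<longlongrightarrow> 0) at_top"
          by (intro tendsto_divide_0[OF tendsto_const]) (auto intro: filterlim_at_top_imp_at_infinity filterlim_ident)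
      qed
      moreover have "\<forall>\<^sub>F Y in at_top. c * ((iexp (l * Y) - 1) / (\<i> * l * Y)) = (\<integral>y. c * iexp (l * y) \<partial>unif Y)"
        using eventually_gt_at_top[of "0::real"]
        by eventually_elim (use False integral_iexp_unif in simp)
      ultimately have "((\<lambda>Y. \<integral>y. c * iexp (l * y) \<partial>unif Y) \<longlongrightarrow> 0) at_top"
        by (rule Lim_transform_eventually)
      then show ?thesis ..
    qed
  next
    case (add f g)
    then obtain a b where "((\<lambda>Y. \<integral>y. f y \<partial>unif Y) \<longlongrightarrow> a) at_top" "((\<lambda>Y. \<integral>y. g y \<partial>unif Y) \<longlongrightarrow> b) at_top"
      by blast
    then have "((\<lambda>Y. (\<integral>y. f y \<partial>unif Y) + (\<integral>y. g y \<partial>unif Y)) \<longlongrightarrow> a + b) at_top"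
      by (rule tendsto_add)
    moreover have "\<forall>\<^sub>F Y in at_top. (\<integral>y. f y \<partial>unif Y) + (\<integral>y. g y \<partial>unif Y) = (\<integral>y. f y + g y \<partial>unif Y)"
      using eventually_gt_at_top[of "0::real"]
    proof eventually_elim
      case (elim Y)
      obtain B C where "\<And>y. norm (f y) \<le> B" "\<And>y. norm (g y) \<le> C"
        using trig_poly_bounded[OF add.hyps(1)] trig_poly_bounded[OF add.hyps(2)] by metis
      then have "integrable (unif Y) f" "integrable (unif Y) g"
        using elim add.hyps
        by (auto intro!: integrable_unif_bounded borel_measurable_lebesgue_continuous trig_poly_continuous)
      then show ?case by simp
    qed
    ultimately have "((\<lambda>Y. (\<integral>y. f y + g y \<partial>unif Y)) \<longlongrightarrow> a + b) at_top"
      by (rule Lim_transform_eventually)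
    then show ?case ..
  qed
  with that show thesis by blast
qed

text \<open>The limit \<open>m\<close> may vary with \<open>e\<close>, so no candidate for the limit
  of \<open>F\<close> is at hand; instead the approximants force \<open>F\<close> to be Cauchy, and
  completeness does the rest.\<close>

lemma convergent_by_approximation:
  fixes F :: "'b \<Rightarrow> 'a::complete_space"
  assumes "\<And>e. e > 0 \<Longrightarrow> \<exists>G m. (G \<longlongrightarrow> m) A \<and> (\<forall>\<^sub>F x in A. dist (F x) (G x) \<le> e)"
  obtains m where "(F \<longlongrightarrow> m) A"
proof -
  have "cauchy_filter (filtermap F A)"
    unfolding cauchy_filter_metric_filtermap
  proof (intro allI impI)
    fix e :: real assume "e > 0"
    then obtain G m where "(G \<longlongrightarrow> m) A" and ev: "\<forall>\<^sub>F x in A. dist (F x) (G x) \<le> e/4"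
      using assms[of "e/4"] by auto
    then have "\<forall>\<^sub>F x in A. dist (G x) m < e/4"
      using \<open>e > 0\<close> by (intro tendstoD) auto
    with ev have "\<forall>\<^sub>F x in A. dist (F x) m < e/2"
    proof eventually_elim
      case (elim x)
      then show ?case using dist_triangle[of "F x" m "G x"] by simp
    qed
    then show "\<exists>P. eventually P A \<and> (\<forall>x y. P x \<and> P y \<longrightarrow> dist (F x) (F y) < e)"
      by (meson dist_triangle_half_l)
  qed
  then have "convergent_filter (filtermap F A)"
    by (rule cauchy_filter_convergent)
  with that show thesis
    by (auto simp: convergent_filter_iff filterlim_def)
qed

text \<open>By Weierstrass, continuous functions of a real trigonometric polynomial are uniform limits
  of trigonometric polynomials, so no equidistribution theorem is needed.\<close>

lemma trig_poly_compose_mean: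
  fixes P h :: "real \<Rightarrow> real"
  assumes P: "trig_poly (\<lambda>y. complex_of_real (P y))" and h: "continuous_on UNIV h"
  obtains m where "((\<lambda>Y. \<integral>y. h (P y) \<partial>unif Y) \<longlongrightarrow> m) at_top"
proof -
  obtain B where B: "\<bar>P y\<bar> \<le> B" for y
    using trig_poly_bounded[OF P] by auto
  have contP: "continuous_on UNIV P"
    using continuous_on_Re[OF trig_poly_continuous[OF P]] by simp
  have "\<exists>G m. (G \<longlongrightarrow> m) at_top \<and> (\<forall>\<^sub>F Y in at_top. dist (\<integral>y. h (P y) \<partial>unif Y) (G Y) \<le> e)"
    if "e > 0" for e
  proof -
    \<comment> \<open>\<open>[-B, B]\<close> contains the range of \<open>P\<close>, so uniform
      approximation on this compact interval is enough.\<close>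
    obtain g where g: "real_polynomial_function g" "\<And>x. x \<in> {-B..B} \<Longrightarrow> \<bar>h x - g x\<bar> < e"
      using Stone_Weierstrass_real_polynomial_function[of "{-B..B}" h e] \<open>e > 0\<close>
        continuous_on_subset[OF h] by (metis compact_Icc subset_UNIV)
    have trig: "trig_poly (\<lambda>y. complex_of_real (g (P y)))"
      using g(1)
    proof induction
      case (linear f)
      then obtain c where "f = (\<lambda>x. x * c)"
        using real_bounded_linear by metis
      then show ?case
        using trig_poly_mult[OF P trig_poly_const[of "of_real c"]] by simp
    next
      case (const c)
      then show ?case by (simp add: trig_poly_const)
    next
      case (add f g)
      then show ?case using trig_poly.add by simp
    next
      case (mult f g)
      then show ?case using trig_poly_mult by simp
    qed
    obtain m where m: "((\<lambda>Y. \<integral>y. complex_of_real (g (P y)) \<partial>unif Y) \<longlongrightarrow> m) at_top"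
      using trig_poly_mean[OF trig] .
    have "((\<lambda>Y. \<integral>y. g (P y) \<partial>unif Y) \<longlongrightarrow> Re m) at_top"
      using tendsto_Re[OF m] by simp
    moreover have "\<forall>\<^sub>F Y in at_top. dist (\<integral>y. h (P y) \<partial>unif Y) (\<integral>y. g (P y) \<partial>unif Y) \<le> e"
      using eventually_gt_at_top[of "0::real"]
    proof eventually_elim
      case (elim Y)
      interpret prob_space "unif Y" by (rule prob_space_unif) fact
      have "compact (h ` {-B..B})"
        using h by (intro compact_continuous_image continuous_on_subset[OF h]) auto
      then obtain C where C: "\<And>x. x \<in> {-B..B} \<Longrightarrow> norm (h x) \<le> C"
        by (meson bounded_iff compact_imp_bounded image_eqI)
      obtain D where D: "\<And>y. norm (complex_of_real (g (P y))) \<le> D"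
        using trig_poly_bounded[OF trig] by blast
      have "P y \<in> {-B..B}" for y
        using B[of y] by auto
      then have i1: "integrable (unif Y) (\<lambda>y. h (P y))"
        using elim C
        by (intro integrable_unif_bounded[where B=C] borel_measurable_lebesgue_continuous
            continuous_on_compose2[OF h contP]) auto
      have "continuous_on UNIV (\<lambda>y. g (P y))"
        using continuous_on_Re[OF trig_poly_continuous[OF trig]] by simp
      then have i2: "integrable (unif Y) (\<lambda>y. g (P y))"
        using elim D
        by (intro integrable_unif_bounded[where B=D] borel_measurable_lebesgue_continuous) auto
      have "\<bar>(\<integral>y. h (P y) \<partial>unif Y) - (\<integral>y. g (P y) \<partial>unif Y)\<bar> = \<bar>\<integral>y. h (P y) - g (P y) \<partial>unif Y\<bar>"
        using i1 i2 by simp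
      also have "\<dots> \<le> (\<integral>y. \<bar>h (P y) - g (P y)\<bar> \<partial>unif Y)"
        by (rule integral_abs_bound)
      also have "\<dots> \<le> (\<integral>y. e \<partial>unif Y)"
        using i1 i2 g(2) \<open>\<And>y. P y \<in> {-B..B}\<close> by (intro integral_mono) (auto intro: less_imp_le)
      also have "\<dots> = e"
        using prob_space by simp
      finally show ?case
        by (auto simp: dist_real_def)
    qed
    ultimately show ?thesis by blast
  qed
  then obtain m where "((\<lambda>Y. \<integral>y. h (P y) \<partial>unif Y) \<longlongrightarrow> m) at_top"
    by (rule convergent_by_approximation)
  then show thesis
    by (rule that)
qed

section \<open>Mean powers of exponential sums\<close>

text \<open>After the substitution \<open>y = Y * u\<close> the interval becomes
  \<open>[0, 1]\<close>, where the standard normal density is at least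
  \<open>exp (-1/2) / sqrt (2 * pi)\<close>. A Gaussian weight is preferred to the indicator since
  its Fourier transform is positive and decays fast.\<close>

lemma integral_unif_le_normal:
  fixes f :: "real \<Rightarrow> real"
  assumes cont: "continuous_on UNIV f" and f: "\<And>y. 0 \<le> f y" "\<And>y. f y \<le> B" and Y: "Y > 0"
  shows "(\<integral>y. f y \<partial>unif Y) \<le> sqrt (2 * pi) * exp (1/2) * (\<integral>u. f (Y * u) \<partial>std_normal_distribution)"
proof -
  interpret N: real_distribution std_normal_distribution
    by (rule real_dist_normal_dist)
  have [measurable]: "f \<in> borel_measurable borel"
    using cont by (rule borel_measurable_continuous_onI)
  have intN: "integrable std_normal_distribution (\<lambda>u. f (Y * u))"
    using f by (intro N.integrable_const_bound[where B=B]) auto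
  then have int: "integrable lborel (\<lambda>u. std_normal_density u * f (Y * u))"
    by (subst (asm) integrable_density) auto
  have "(\<integral>y. f y \<partial>unif Y) = (1/Y) * (LINT y:{0..Y}|lebesgue. f y)"
    using integral_unif[of f Y] Y by (simp add: measurable_completion)
  also have "(LINT y:{0..Y}|lebesgue. f y) = (\<integral>y. indicator {0..Y} y * f y \<partial>lborel)"
    unfolding set_lebesgue_integral_def by (subst integral_completion) auto
  also have "\<dots> = Y * (\<integral>u. indicator {0..Y} (0 + Y * u) * f (0 + Y * u) \<partial>lborel)"
    using Y by (subst lborel_integral_real_affine[where c=Y and t=0]) auto
  also have "(1/Y) * (Y * (\<integral>u. indicator {0..Y} (0 + Y * u) * f (0 + Y * u) \<partial>lborel))
      = (\<integral>u. indicator {0..Y} (0 + Y * u) * f (0 + Y * u) \<partial>lborel)"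
    using Y by simp
  also have "\<dots> \<le> (\<integral>u. sqrt (2 * pi) * exp (1/2) * (std_normal_density u * f (Y * u)) \<partial>lborel)"
  proof (rule integral_mono')
    show "integrable lborel (\<lambda>u. sqrt (2 * pi) * exp (1/2) * (std_normal_density u * f (Y * u)))"
      using int by simp
    fix u
    have "indicator {0..Y} (0 + Y * u) \<le> sqrt (2 * pi) * exp (1/2) * std_normal_density u"
    proof (cases "0 \<le> u \<and> u \<le> 1")
      case True
      then have "u\<^sup>2 \<le> 1"
        by (simp add: power_le_one)
      then have "(1::real) \<le> exp (1/2 - u\<^sup>2 / 2)"
        by simp
      also have "\<dots> = sqrt (2 * pi) * exp (1/2) * std_normal_density u"
        by (simp add: std_normal_density_def flip: exp_add)
      finally show ?thesis
        using indicator_le_1 order_trans by blast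
    next
      case False
      then have "0 + Y * u \<notin> {0..Y}"
        using Y by (auto simp: zero_le_mult_iff)
      then show ?thesis by simp
    qed
    from mult_right_mono[OF this f(1)]
    show "indicator {0..Y} (0 + Y * u) * f (0 + Y * u)
        \<le> sqrt (2 * pi) * exp (1/2) * (std_normal_density u * f (Y * u))"
      by (simp add: mult.assoc)
    show "0 \<le> sqrt (2 * pi) * exp (1/2) * (std_normal_density u * f (Y * u))"
      using f by simp
  qed
  also have "\<dots> = sqrt (2 * pi) * exp (1/2) * (\<integral>u. f (Y * u) \<partial>std_normal_distribution)"
    by (subst integral_density) auto
  finally show ?thesis .
qed

definition exp_sum :: "('a \<Rightarrow> real) \<Rightarrow> ('a \<Rightarrow> complex) \<Rightarrow> 'a set \<Rightarrow> real \<Rightarrow> complex" where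
  "exp_sum lam r A y = (\<Sum>n\<in>A. r n * iexp (lam n * y))"

lemma continuous_on_exp_sum [continuous_intros]: "continuous_on S (exp_sum lam r A)"
  unfolding exp_sum_def by (intro continuous_intros)

lemma trig_poly_exp_sum:
  "finite A \<Longrightarrow> trig_poly (exp_sum lam r A)"
  unfolding exp_sum_def by (intro trig_poly_sum trig_poly.monomial) auto

lemma norm_exp_sum_le: "norm (exp_sum lam r A y) \<le> (\<Sum>n\<in>A. norm (r n))"
  unfolding exp_sum_def by (rule order_trans[OF norm_sum]) (simp add: norm_mult)

text \<open>Expanding the square, the cross term of \<open>n\<close> and \<open>m\<close> integrates
  to the normal characteristic function at \<open>Y * (lam n - lam m)\<close>, which is the Gaussian
  factor on the right.\<close>

lemma integral_normal_exp_sum: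
  "(\<integral>u. (norm (exp_sum lam r A (Y * u)))\<^sup>2 \<partial>std_normal_distribution)
    \<le> (\<Sum>n\<in>A. \<Sum>m\<in>A. norm (r n) * norm (r m) * exp (- (Y * (lam n - lam m))\<^sup>2 / 2))"
proof -
  interpret N: real_distribution std_normal_distribution
    by (rule real_dist_normal_dist)
  let ?c = "\<lambda>n m. r n * cnj (r m)"
  let ?t = "\<lambda>n m. Y * (lam n - lam m)"
  have int: "integrable std_normal_distribution (\<lambda>u. iexp (t * u))" for t
    using N.integrable_iexp[of "\<lambda>u. of_real (t * u)"] by simp
  have mult_cnj: "(r n * iexp (lam n * (Y * u))) * cnj (r m * iexp (lam m * (Y * u))) = ?c n m * iexp (?t n m * u)" for n m u
  proof -
    have "iexp (lam n * (Y * u)) * cnj (iexp (lam m * (Y * u))) = iexp (?t n m * u)"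
      by (simp add: exp_cnj algebra_simps flip: exp_add)
    then show ?thesis by (simp add: mult_ac)
  qed
  have "complex_of_real ((norm (exp_sum lam r A (Y * u)))\<^sup>2) = (\<Sum>n\<in>A. \<Sum>m\<in>A. ?c n m * iexp (?t n m * u))" for u
    unfolding complex_norm_square exp_sum_def cnj_sum sum_product mult_cnj ..
  then have "complex_of_real (\<integral>u. (norm (exp_sum lam r A (Y * u)))\<^sup>2 \<partial>std_normal_distribution)
      = (\<integral>u. (\<Sum>n\<in>A. \<Sum>m\<in>A. ?c n m * iexp (?t n m * u)) \<partial>std_normal_distribution)"
    by (simp flip: integral_complex_of_real)
  also have "\<dots> = (\<Sum>n\<in>A. \<Sum>m\<in>A. ?c n m * char std_normal_distribution (?t n m))"
    unfolding char_def using int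
    by (simp add: Bochner_Integration.integral_sum del: of_real_mult of_real_diff)
  also have "norm \<dots> \<le> (\<Sum>n\<in>A. \<Sum>m\<in>A. norm (r n) * norm (r m) * exp (- (?t n m)\<^sup>2 / 2))"
    by (intro sum_norm_le) (simp add: norm_mult char_std_normal_distribution norm_exp_eq_Re)
  finally show ?thesis
    by (simp add: integral_nonneg_AE)
qed

text \<open>Two one-sided geometric series; the index \<open>0\<close> is covered by both.\<close>

lemma sum_power_nat_abs_le:
  fixes a :: real
  assumes "finite I" "0 \<le> a" "a < 1"
  shows "(\<Sum>i\<in>I. a ^ nat \<bar>i\<bar>) \<le> 2 / (1 - a)"
proof -
  define N where "N = nat (Max (insert 0 (abs ` I)))"
  have I: "I \<subseteq> int ` {..N} \<union> (\<lambda>k. - int k) ` {..N}"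
  proof
    fix i assume "i \<in> I"
    then have "\<bar>i\<bar> \<le> Max (insert 0 (abs ` I))"
      using assms by (intro Max_ge) auto
    then have "nat \<bar>i\<bar> \<in> {..N}"
      unfolding N_def by auto
    then show "i \<in> int ` {..N} \<union> (\<lambda>k. - int k) ` {..N}"
      by (cases "i \<ge> 0") (auto simp: image_iff intro!: bexI[of _ "nat \<bar>i\<bar>"])
  qed
  have geo: "(\<Sum>k\<le>N. a ^ k) \<le> 1 / (1 - a)"
    using assms sum_le_suminf[of "\<lambda>k. a ^ k" "{..N}"] by (simp add: suminf_geometric summable_geometric)
  have "(\<Sum>i\<in>I. a ^ nat \<bar>i\<bar>) \<le> (\<Sum>i\<in>int ` {..N} \<union> (\<lambda>k. - int k) ` {..N}. a ^ nat \<bar>i\<bar>)"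
    using assms I by (intro sum_mono2) auto
  also have "\<dots> \<le> (\<Sum>i\<in>int ` {..N}. a ^ nat \<bar>i\<bar>) + (\<Sum>i\<in>(\<lambda>k. - int k) ` {..N}. a ^ nat \<bar>i\<bar>)"
    using assms by (subst sum_Un) (auto intro: sum_nonneg)
  also have "\<dots> = (\<Sum>k\<le>N. a ^ k) + (\<Sum>k\<le>N. a ^ k)"
    by (subst (1 2) sum.reindex) (auto simp: inj_on_def)
  finally show ?thesis
    using geo by simp
qed

text \<open>The terms are grouped by the integer part of \<open>lam n - x\<close>: each group lies
  in a unit window of mass at most \<open>M\<close>, and its Gaussian factors decay geometrically in
  the distance of the window.\<close>

lemma sum_gaussian_weights_le:
  fixes w lam :: "'a \<Rightarrow> real"
  assumes A: "finite A" and w: "\<And>n. n \<in> A \<Longrightarrow> 0 \<le> w n"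
    and win: "\<And>t. (\<Sum>n | n \<in> A \<and> t \<le> lam n \<and> lam n \<le> t + 1. w n) \<le> M"
  shows "(\<Sum>n\<in>A. w n * exp (- (x - lam n)\<^sup>2 / 2)) \<le> exp (3/2) * (2 / (1 - exp (-1))) * M"
proof -
  let ?i = "\<lambda>n. \<lfloor>lam n - x\<rfloor>"
  have "0 \<le> (\<Sum>n | n \<in> A \<and> 0 \<le> lam n \<and> lam n \<le> 0 + 1. w n)"
    using w by (intro sum_nonneg) auto
  then have M: "M \<ge> 0"
    using win[of 0] by simp
  have wt: "exp (- (x - lam n)\<^sup>2 / 2) \<le> exp (3/2) * exp (-1) ^ nat \<bar>?i n\<bar>" for n
  proof -
    \<comment> \<open>This square gives \<open>- d^2 / 2 \<le> 1/2 - \<bar>d\<bar>\<close> for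
      \<open>d = x - lam n\<close>; taking the integer part costs at most 1 more, hence the exponent
      3/2.\<close>
    have "0 \<le> (\<bar>x - lam n\<bar> - 1)\<^sup>2"
      by simp
    then have "- (x - lam n)\<^sup>2 / 2 \<le> 1/2 - \<bar>x - lam n\<bar>"
      by (simp add: power2_diff)
    also have "\<dots> \<le> 3/2 - real (nat \<bar>?i n\<bar>)"
      by linarith
    finally show ?thesis
      by (simp add: exp_of_nat_mult[symmetric] flip: exp_add)
  qed
  have "(\<Sum>n\<in>A. w n * exp (- (x - lam n)\<^sup>2 / 2)) \<le> (\<Sum>n\<in>A. w n * (exp (3/2) * exp (-1) ^ nat \<bar>?i n\<bar>))"
    using w wt by (intro sum_mono mult_left_mono)
  also have "\<dots> = (\<Sum>i\<in>?i ` A. \<Sum>n | n \<in> A \<and> ?i n = i. w n * (exp (3/2) * exp (-1) ^ nat \<bar>?i n\<bar>))"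
    using A by (intro sum.image_gen)
  also have "\<dots> = (\<Sum>i\<in>?i ` A. exp (3/2) * exp (-1) ^ nat \<bar>i\<bar> * (\<Sum>n | n \<in> A \<and> ?i n = i. w n))"
    by (simp add: sum_distrib_left mult_ac)
  also have "\<dots> \<le> (\<Sum>i\<in>?i ` A. exp (3/2) * exp (-1) ^ nat \<bar>i\<bar> * M)"
  proof (intro sum_mono mult_left_mono)
    fix i
    have "(\<Sum>n | n \<in> A \<and> ?i n = i. w n) \<le> (\<Sum>n | n \<in> A \<and> x + of_int i \<le> lam n \<and> lam n \<le> x + of_int i + 1. w n)"
      using A w by (intro sum_mono2) (auto, linarith+)
    then show "(\<Sum>n | n \<in> A \<and> ?i n = i. w n) \<le> M"
      using win order_trans by blast
  qed auto
  also have "\<dots> = exp (3/2) * M * (\<Sum>i\<in>?i ` A. exp (-1) ^ nat \<bar>i\<bar>)"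
    by (simp add: sum_distrib_left mult_ac)
  also have "\<dots> \<le> exp (3/2) * M * (2 / (1 - exp (-1)))"
    using A M by (intro mult_left_mono sum_power_nat_abs_le) auto
  finally show ?thesis
    by (simp add: mult_ac)
qed

text \<open>Product of the constant of the Gaussian comparison and that of the sum over unit
  windows.\<close>

definition ms_const :: real where
  "ms_const = sqrt (2 * pi) * exp (1/2) * (exp (3/2) * (2 / (1 - exp (-1))))"

lemma ms_const_nonneg: "0 \<le> ms_const"
  unfolding ms_const_def by simp

text \<open>Gaussian comparison, then a row-sum bound on the resulting double sum: for each
  \<open>n\<close> the inner sum is at most a constant times \<open>M\<close>. Instead of gaps
  between frequencies, only the mass in unit windows enters.\<close>

lemma mean_square_exp_sum_le:
  assumes A: "finite A" and Y: "Y \<ge> 1"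
    and win: "\<And>t. (\<Sum>n | n \<in> A \<and> t \<le> lam n \<and> lam n \<le> t + 1. norm (r n)) \<le> M"
  shows "(\<integral>y. (norm (exp_sum lam r A y))\<^sup>2 \<partial>unif Y) \<le> ms_const * M * (\<Sum>n\<in>A. norm (r n))"
proof -
  let ?K = "exp (3/2) * (2 / (1 - exp (-1))) :: real"
  have "(\<integral>y. (norm (exp_sum lam r A y))\<^sup>2 \<partial>unif Y)
      \<le> sqrt (2 * pi) * exp (1/2) * (\<integral>u. (norm (exp_sum lam r A (Y * u)))\<^sup>2 \<partial>std_normal_distribution)"
    using Y by (intro integral_unif_le_normal[where B="(\<Sum>n\<in>A. norm (r n))\<^sup>2"] continuous_intros power_mono norm_exp_sum_le) auto
  also have "(\<integral>u. (norm (exp_sum lam r A (Y * u)))\<^sup>2 \<partial>std_normal_distribution)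
      \<le> (\<Sum>n\<in>A. \<Sum>m\<in>A. norm (r n) * norm (r m) * exp (- (Y * (lam n - lam m))\<^sup>2 / 2))"
    by (rule integral_normal_exp_sum)
  also have "\<dots> \<le> (\<Sum>n\<in>A. \<Sum>m\<in>A. norm (r n) * norm (r m) * exp (- (lam n - lam m)\<^sup>2 / 2))"
  proof (intro sum_mono mult_left_mono)
    fix n m
    \<comment> \<open>Enlarging the scale from 1 to \<open>Y\<close> only shrinks the Gaussian
      factors, which makes the bound uniform in \<open>Y\<close>.\<close>
    have "1 * (lam n - lam m)\<^sup>2 \<le> Y\<^sup>2 * (lam n - lam m)\<^sup>2"
      using Y by (intro mult_right_mono) auto
    then show "exp (- (Y * (lam n - lam m))\<^sup>2 / 2) \<le> exp (- (lam n - lam m)\<^sup>2 / 2)"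
      by (simp add: power_mult_distrib)
  qed auto
  also have "\<dots> = (\<Sum>n\<in>A. norm (r n) * (\<Sum>m\<in>A. norm (r m) * exp (- (lam n - lam m)\<^sup>2 / 2)))"
    by (simp add: sum_distrib_left mult_ac)
  also have "\<dots> \<le> (\<Sum>n\<in>A. norm (r n) * (?K * M))"
    using sum_gaussian_weights_le[OF A _ win] by (intro sum_mono mult_left_mono) auto
  also have "(\<Sum>n\<in>A. norm (r n) * (?K * M)) = (\<Sum>n\<in>A. norm (r n)) * (?K * M)"
    by (rule sum_distrib_right[symmetric])
  finally show ?thesis
    by (simp add: ms_const_def mult_left_mono mult_ac)
qed

text \<open>Induction adds one unit window at a time. The interval is open on the left, so it is
  empty for \<open>L = 0\<close>; overlaps of the closed windows are harmless for nonnegative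
  weights.\<close>

lemma sum_le_windows:
  fixes w lam :: "'a \<Rightarrow> real"
  assumes A: "finite A" and w: "\<And>n. n \<in> A \<Longrightarrow> 0 \<le> w n"
    and win: "\<And>t. (\<Sum>n | n \<in> A \<and> t \<le> lam n \<and> lam n \<le> t + 1. w n) \<le> M"
  shows "(\<Sum>n | n \<in> A \<and> a < lam n \<and> lam n \<le> a + real L. w n) \<le> real L * M"
proof (induction L)
  case (Suc L)
  have "(\<Sum>n | n \<in> A \<and> a < lam n \<and> lam n \<le> a + real (Suc L). w n)
    \<le> (\<Sum>n\<in>{n\<in>A. a < lam n \<and> lam n \<le> a + real L} \<union> {n\<in>A. a + L \<le> lam n \<and> lam n \<le> a + L + 1}. w n)"
    using A w by (intro sum_mono2) auto
  also have "\<dots> \<le> (\<Sum>n | n \<in> A \<and> a < lam n \<and> lam n \<le> a + real L. w n)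
      + (\<Sum>n | n \<in> A \<and> a + L \<le> lam n \<and> lam n \<le> a + L + 1. w n)"
    using A w by (subst sum_Un) (auto intro: sum_nonneg)
  also have "\<dots> \<le> real L * M + M"
    using Suc win by (rule add_mono)
  finally show ?case
    by (simp add: algebra_simps)
qed (use A in \<open>auto simp: not_less intro!: sum_nonpos\<close>)

lemma integrable_unif_exp_sum_powr:
  assumes "finite A" "Y > 0" "p \<ge> 0"
  shows "integrable (unif Y) (\<lambda>y. norm (exp_sum lam r A y) powr p)"
proof (intro integrable_unif_bounded)
  have "exp_sum lam r A \<in> borel_measurable lebesgue"
    by (intro borel_measurable_lebesgue_continuous continuous_intros)
  then show "(\<lambda>y. norm (exp_sum lam r A y) powr p) \<in> borel_measurable lebesgue"
    by measurable
  show "norm (norm (exp_sum lam r A y) powr p) \<le> (\<Sum>n\<in>A. norm (r n)) powr p" for y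
    using assms by (auto intro!: powr_mono2 norm_exp_sum_le)
qed fact

text \<open>Interpolation between the trivial sup bound and the mean square.\<close>

lemma mean_powr_exp_sum_le:
  assumes A: "finite A" and Y: "Y \<ge> 1" and p: "p \<ge> 2"
    and win: "\<And>t. (\<Sum>n | n \<in> A \<and> t \<le> lam n \<and> lam n \<le> t + 1. norm (r n)) \<le> M"
    and A_le: "\<And>n. n \<in> A \<Longrightarrow> a < lam n \<and> lam n \<le> a + real L"
  shows "(\<integral>y. norm (exp_sum lam r A y) powr p \<partial>unif Y) \<le> ms_const * real L powr (p - 1) * M powr p"
proof -
  define S where "S = (\<Sum>n\<in>A. norm (r n))"
  have "0 \<le> (\<Sum>n | n \<in> A \<and> 0 \<le> lam n \<and> lam n \<le> 0 + 1. norm (r n))"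
    by (intro sum_nonneg) auto
  then have M: "M \<ge> 0"
    using win[of 0] by simp
  have S0: "S \<ge> 0"
    unfolding S_def by (intro sum_nonneg) auto
  have "{n \<in> A. a < lam n \<and> lam n \<le> a + real L} = A"
    using A_le by auto
  then have S: "S \<le> real L * M"
    using sum_le_windows[OF A _ win, of a L] by (simp add: S_def)
  have split: "x powr p = x powr (p - 2) * x\<^sup>2" if "x \<ge> 0" for x :: real
    using that powr_add[of x "p - 2" 2] by (cases "x = 0") (auto simp: powr_numeral)
  have int: "integrable (unif Y) (\<lambda>y. (norm (exp_sum lam r A y))\<^sup>2)"
    using integrable_unif_exp_sum_powr[OF A, of Y 2 lam r] Y by simp
  have "(\<integral>y. norm (exp_sum lam r A y) powr p \<partial>unif Y)
      \<le> (\<integral>y. S powr (p - 2) * (norm (exp_sum lam r A y))\<^sup>2 \<partial>unif Y)"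
  proof (rule integral_mono)
    show "integrable (unif Y) (\<lambda>y. norm (exp_sum lam r A y) powr p)"
      using A Y p by (intro integrable_unif_exp_sum_powr) auto
    show "integrable (unif Y) (\<lambda>y. S powr (p - 2) * (norm (exp_sum lam r A y))\<^sup>2)"
      using int by simp
    show "norm (exp_sum lam r A y) powr p \<le> S powr (p - 2) * (norm (exp_sum lam r A y))\<^sup>2" for y
      unfolding split[OF norm_ge_zero] S_def
      using p by (intro mult_right_mono powr_mono2 norm_exp_sum_le) auto
  qed
  \<comment> \<open>The mean square supplies one more factor \<open>S\<close>, so the total power of
    \<open>S\<close> is \<open>p - 1\<close>; only then is \<open>S \<le> real L * M\<close>
    inserted.\<close>
  also have "\<dots> \<le> S powr (p - 2) * (ms_const * M * S)"
    using mean_square_exp_sum_le[OF A Y win] by (auto simp: S_def intro!: mult_left_mono)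
  also have "\<dots> = ms_const * M * S powr (p - 1)"
    using S0 powr_add[of S "p - 2" 1] by simp
  also have "\<dots> \<le> ms_const * M * (real L * M) powr (p - 1)"
    using S S0 M p ms_const_nonneg by (intro mult_left_mono powr_mono2) auto
  also have "\<dots> = ms_const * real L powr (p - 1) * M powr p"
    using M powr_add[of M "p - 1" 1] by (simp add: powr_mult)
  finally show ?thesis .
qed

section \<open>Summation over dyadic blocks\<close>

lemma powr_add_le_weighted:
  fixes a b :: real
  assumes "a \<ge> 0" "b \<ge> 0" "0 < t" "t < 1" "p \<ge> 1"
  shows "(a + b) powr p \<le> (1 - t) powr (1 - p) * a powr p + t powr (1 - p) * b powr p"
proof -
  have ge1: "s powr (1 - p) \<ge> 1" if "0 < s" "s < 1" for s :: real
    using powr_mono2'[of "1 - p" s 1] that assms by simp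
  have scale: "s * (x / s) powr p = s powr (1 - p) * x powr p" if "0 < s" "x \<ge> 0" for s x :: real
    using that by (simp add: powr_divide powr_diff)
  show ?thesis
  proof (cases "a = 0 \<or> b = 0")
    case True
    then show ?thesis
      using ge1[of t] ge1[of "1 - t"] assms mult_right_mono[of 1 _ "a powr p"] mult_right_mono[of 1 _ "b powr p"]
      by auto
  next
    case False
    \<comment> \<open>Convexity of the \<open>p\<close>-th power at the positive points
      \<open>a / (1 - t)\<close> and \<open>b / t\<close>, whose mean with weights
      \<open>1 - t\<close> and \<open>t\<close> is \<open>a + b\<close>.\<close>
    then have "((1 - t) *\<^sub>R (a / (1 - t)) + t *\<^sub>R (b / t)) powr p
        \<le> (1 - t) * (a / (1 - t)) powr p + t * (b / t) powr p"
      using assms by (intro convex_onD[OF powr_convex]) auto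
    then show ?thesis
      using assms scale[of t b] scale[of "1 - t" a] by simp
  qed
qed

text \<open>Splitting off the lowest dyadic block with the convexity weight \<open>t\<close> costs a factor
  \<open>t^(1-p)\<close> on the remaining tail, which \<open>q = 2^(-\<theta>)\<close> absorbs if \<open>t\<close> is close to \<open>1\<close>.\<close>

lemma mean_powr_exp_sum_tail:
  fixes lam :: "nat \<Rightarrow> real"
  assumes fin: "\<And>X. finite {n. lam n \<le> X}"
    and win: "\<And>T. T \<ge> T0 \<Longrightarrow> (\<Sum>n | T \<le> lam n \<and> lam n \<le> T + 1. norm (r n)) \<le> C * T powr (- \<beta>)"
    and C: "C \<ge> 0" and \<beta>: "\<beta> \<ge> 0" and p: "p \<ge> 2" and \<theta>: "p * (1 - \<beta>) < 1"
  obtains K q where "0 < q" "q < 1"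
    "\<forall>J A Y. T0 \<le> 2 ^ J \<longrightarrow> finite A \<longrightarrow> (\<forall>n\<in>A. 2 ^ J < lam n) \<longrightarrow> Y \<ge> 1 \<longrightarrow>
      (\<integral>y. norm (exp_sum lam r A y) powr p \<partial>unif Y) \<le> K * q ^ J"
proof -
  define \<theta> where "\<theta> = 1 - p * (1 - \<beta>)"
  define q where "q = (2::real) powr (- \<theta>)"
  \<comment> \<open>With this choice \<open>t powr (1 - p)\<close> equals
    \<open>2 powr (\<theta> * (p - 1) / (2 * p))\<close>, which costs less than half of the exponent
    gained in \<open>q\<close>; hence \<open>s < 1\<close> below.\<close>
  define t where "t = (2::real) powr (- (\<theta> / (2 * p)))"
  define s where "s = t powr (1 - p) * q"
  define K1 where "K1 = ms_const * C powr p"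
  \<comment> \<open>\<open>K\<close> solves \<open>(1 - t) powr (1 - p) * K1 + s * K = K\<close>, so
    the recursion over blocks reproduces the same constant.\<close>
  define K where "K = (1 - t) powr (1 - p) * K1 / (1 - s)"
  have "\<theta> > 0"
    using \<theta> by (simp add: \<theta>_def)
  have q: "0 < q" "q < 1"
    using \<open>\<theta> > 0\<close> by (auto simp: q_def powr_less_one)
  have t: "0 < t" "t < 1"
    using \<open>\<theta> > 0\<close> p by (auto simp: t_def powr_less_one)
  have "- (\<theta> / (2 * p)) * (1 - p) + - \<theta> = - (\<theta> * ((p + 1) / (2 * p)))"
    using p by (simp add: field_simps)
  then have "s = 2 powr - (\<theta> * ((p + 1) / (2 * p)))"
    unfolding s_def t_def q_def powr_powr powr_add[symmetric] by simp
  then have s: "0 < s" "s < 1"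
    using \<open>\<theta> > 0\<close> p by (auto simp: powr_less_one)
  have K1: "K1 \<ge> 0"
    by (simp add: K1_def ms_const_nonneg)
  then have K: "K \<ge> 0"
    using s by (simp add: K_def)
  have rec: "(1 - t) powr (1 - p) * K1 + s * K = K"
    using s by (simp add: K_def field_simps)
  have block: "(\<integral>y. norm (exp_sum lam r B y) powr p \<partial>unif Y) \<le> K1 * q ^ j"
    if j: "T0 \<le> 2 ^ j" and B: "finite B" "\<And>n. n \<in> B \<Longrightarrow> 2 ^ j < lam n \<and> lam n \<le> 2 ^ Suc j" and Y: "Y \<ge> 1"
    for j B Y
  proof -
    let ?M = "C * (2 ^ j) powr (- \<beta>)"
    \<comment> \<open>With block length \<open>2 ^ j\<close> and window mass \<open>?M\<close> the
      interpolated bound is of order \<open>2 powr (j * (p - 1 - \<beta> * p))\<close>, and this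
      exponent is \<open>- \<theta> * j\<close>.\<close>
    have "(\<integral>y. norm (exp_sum lam r B y) powr p \<partial>unif Y) \<le> ms_const * real (2 ^ j) powr (p - 1) * ?M powr p"
    proof (rule mean_powr_exp_sum_le[where a="2 ^ j"])
      fix x :: real
      \<comment> \<open>A window starting below the block meets it only inside the window starting
        at \<open>2 ^ j\<close>; moving the start up keeps \<open>win\<close> applicable.\<close>
      let ?x = "max x (2 ^ j)"
      have "(\<Sum>n | n \<in> B \<and> x \<le> lam n \<and> lam n \<le> x + 1. norm (r n))
          \<le> (\<Sum>n | ?x \<le> lam n \<and> lam n \<le> ?x + 1. norm (r n))"
        using B(2) by (intro sum_mono2 finite_subset[OF _ fin[of "?x + 1"]]) (auto intro: less_imp_le simp: max_def)
      also have "\<dots> \<le> C * ?x powr (- \<beta>)"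
        using j by (intro win) auto
      also have "\<dots> \<le> ?M"
        using C \<beta> by (intro mult_left_mono powr_mono2') auto
      finally show "(\<Sum>n | n \<in> B \<and> x \<le> lam n \<and> lam n \<le> x + 1. norm (r n)) \<le> ?M" .
    qed (use B Y p in auto)
    also have "\<dots> = K1 * q ^ j"
    proof -
      have "real (2 ^ j) powr (p - 1) * ?M powr p = C powr p * ((2 ^ j) powr (p - 1) * (2 ^ j) powr (- \<beta> * p))"
        using C by (simp add: powr_mult powr_powr mult_ac)
      also have "(2 ^ j :: real) powr (p - 1) * (2 ^ j) powr (- \<beta> * p) = (2 ^ j) powr (- \<theta>)"
        by (simp add: \<theta>_def flip: powr_add) (simp add: algebra_simps)
      also have "\<dots> = q ^ j"
        by (simp add: q_def powr_realpow[symmetric] powr_powr mult.commute)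
      finally show ?thesis
        by (simp add: K1_def)
    qed
    finally show ?thesis .
  qed
  \<comment> \<open>Induction on the number \<open>k\<close> of dyadic blocks that cover
    \<open>A\<close>, with \<open>J\<close> varying; the bound does not depend on
    \<open>k\<close>.\<close>
  have tail: "(\<integral>y. norm (exp_sum lam r A y) powr p \<partial>unif Y) \<le> K * q ^ J"
    if "T0 \<le> 2 ^ J" "finite A" "\<And>n. n \<in> A \<Longrightarrow> 2 ^ J < lam n \<and> lam n \<le> 2 ^ (J + k)" "Y \<ge> 1"
    for J A Y k
    using that
  proof (induction k arbitrary: J A)
    case 0
    then have "A = {}" by force
    then show ?case
      using K q by (simp add: exp_sum_def)
  next
    case (Suc k)
    define B where "B = {n\<in>A. lam n \<le> 2 ^ Suc J}"
    have B: "finite B" "finite (A - B)"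
      using Suc.prems by (auto simp: B_def)
    have split: "exp_sum lam r A y = exp_sum lam r B y + exp_sum lam r (A - B) y" for y
      unfolding exp_sum_def using Suc.prems by (subst add.commute, intro sum.subset_diff) (auto simp: B_def)
    have IB: "(\<integral>y. norm (exp_sum lam r B y) powr p \<partial>unif Y) \<le> K1 * q ^ J"
      using Suc.prems B by (intro block) (auto simp: B_def)
    have "T0 \<le> 2 ^ Suc J"
      using Suc.prems(1) by (simp add: order_trans[OF _ mult_right_mono[of 1 2]])
    then have IA: "(\<integral>y. norm (exp_sum lam r (A - B) y) powr p \<partial>unif Y) \<le> K * q ^ Suc J"
      using Suc.prems B by (intro Suc.IH) (auto simp: B_def)
    note int = integrable_unif_exp_sum_powr[of _ Y p lam r]
    have "(\<integral>y. norm (exp_sum lam r A y) powr p \<partial>unif Y)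
        \<le> (\<integral>y. (1 - t) powr (1 - p) * norm (exp_sum lam r B y) powr p
              + t powr (1 - p) * norm (exp_sum lam r (A - B) y) powr p \<partial>unif Y)"
    proof (rule integral_mono)
      fix y
      have "norm (exp_sum lam r A y) powr p \<le> (norm (exp_sum lam r B y) + norm (exp_sum lam r (A - B) y)) powr p"
        unfolding split using p by (intro powr_mono2 norm_triangle_ineq) auto
      also have "\<dots> \<le> (1 - t) powr (1 - p) * norm (exp_sum lam r B y) powr p
              + t powr (1 - p) * norm (exp_sum lam r (A - B) y) powr p"
        using t p by (intro powr_add_le_weighted) auto
      finally show "norm (exp_sum lam r A y) powr p \<le> \<dots>" .
    qed (use int Suc.prems B p in auto)
    also have "\<dots> = (1 - t) powr (1 - p) * (\<integral>y. norm (exp_sum lam r B y) powr p \<partial>unif Y)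
        + t powr (1 - p) * (\<integral>y. norm (exp_sum lam r (A - B) y) powr p \<partial>unif Y)"
      using int Suc.prems B p by simp
    also have "\<dots> \<le> (1 - t) powr (1 - p) * (K1 * q ^ J) + t powr (1 - p) * (K * q ^ Suc J)"
      using IA IB by (intro add_mono mult_left_mono) auto
    also have "\<dots> = ((1 - t) powr (1 - p) * K1 + s * K) * q ^ J"
      by (simp add: s_def algebra_simps)
    finally show ?case
      by (simp add: rec)
  qed
  show thesis
  proof (rule that[OF q], intro allI impI)
    fix J A Y
    assume *: "T0 \<le> 2 ^ J" "finite A" "\<forall>n\<in>A. 2 ^ J < lam n" "(Y::real) \<ge> 1"
    obtain k where k: "Max (insert 0 (lam ` A)) < 2 ^ k"
      using real_arch_pow[of 2 "Max (insert 0 (lam ` A))"] by auto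
    have "lam n \<le> 2 ^ (J + k)" if "n \<in> A" for n
    proof -
      have "lam n \<le> Max (insert 0 (lam ` A))"
        using that * by (intro Max_ge) auto
      also have "\<dots> \<le> 2 ^ (J + k)"
        using k power_increasing[of k "J + k" "2::real"] by linarith
      finally show ?thesis .
    qed
    then show "(\<integral>y. norm (exp_sum lam r A y) powr p \<partial>unif Y) \<le> K * q ^ J"
      using * by (intro tail) auto
  qed
qed

section \<open>Besicovitch almost periodic functions\<close>

text \<open>The explicit integrability excludes the default value \<open>0\<close> of the Bochner
  integral. A bound for all large \<open>Y\<close> takes the place of an upper limit.\<close>

definition besicovitch_ap :: "real \<Rightarrow> (real \<Rightarrow> real) \<Rightarrow> bool" where
  "besicovitch_ap p f \<longleftrightarrow> f \<in> borel_measurable lebesgue \<and>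
     (\<forall>e>0. \<exists>P. trig_poly (\<lambda>y. complex_of_real (P y)) \<and>
        (\<forall>\<^sub>F Y in at_top. integrable (unif Y) (\<lambda>y. \<bar>f y - P y\<bar> powr p) \<and>
           (\<integral>y. \<bar>f y - P y\<bar> powr p \<partial>unif Y) \<le> e))"

lemma besicovitch_ap_measurable: "besicovitch_ap p f \<Longrightarrow> f \<in> borel_measurable lebesgue"
  by (simp add: besicovitch_ap_def)

lemma besicovitch_apE:
  assumes "besicovitch_ap p f" "e > 0"
  obtains P D where "trig_poly (\<lambda>y. complex_of_real (P y))" "P \<in> borel_measurable lebesgue"
    "continuous_on UNIV P" "D \<ge> 0" "\<And>y. \<bar>P y\<bar> \<le> D"
    "\<forall>\<^sub>F Y in at_top. integrable (unif Y) (\<lambda>y. \<bar>f y - P y\<bar> powr p) \<and>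
       (\<integral>y. \<bar>f y - P y\<bar> powr p \<partial>unif Y) \<le> e"
proof -
  from assms have "\<exists>P. trig_poly (\<lambda>y. complex_of_real (P y)) \<and>
    (\<forall>\<^sub>F Y in at_top. integrable (unif Y) (\<lambda>y. \<bar>f y - P y\<bar> powr p) \<and>
       (\<integral>y. \<bar>f y - P y\<bar> powr p \<partial>unif Y) \<le> e)"
    by (simp add: besicovitch_ap_def)
  then obtain P where P: "trig_poly (\<lambda>y. complex_of_real (P y))"
    "\<forall>\<^sub>F Y in at_top. integrable (unif Y) (\<lambda>y. \<bar>f y - P y\<bar> powr p) \<and>
       (\<integral>y. \<bar>f y - P y\<bar> powr p \<partial>unif Y) \<le> e"
    by (elim exE conjE)
  have cont: "continuous_on UNIV P"
    using continuous_on_Re[OF trig_poly_continuous[OF P(1)]] by simp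
  obtain D where D: "norm (complex_of_real (P y)) \<le> D" for y
    by (rule trig_poly_bounded[OF P(1)]) (rule that)
  then have bound: "\<bar>P y\<bar> \<le> D" for y
    by simp
  have "D \<ge> 0"
    using bound[of 0] by linarith
  then show thesis
    by (rule that[OF P(1) borel_measurable_lebesgue_continuous[OF cont] cont _ bound P(2)])
qed

lemma powr_add_le_2:
  fixes a b :: real
  assumes "a \<ge> 0" "b \<ge> 0" "p \<ge> 0"
  shows "(a + b) powr p \<le> 2 powr p * (a powr p + b powr p)"
proof -
  have "(a + b) powr p \<le> (2 * max a b) powr p"
    using assms by (intro powr_mono2) auto
  also have "\<dots> = 2 powr p * max a b powr p"
    using assms by (simp add: powr_mult)
  also have "\<dots> \<le> 2 powr p * (a powr p + b powr p)"
    by (intro mult_left_mono) (auto simp: max_def)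
  finally show ?thesis .
qed

lemma power_le_one_plus_powr:
  fixes x :: real
  assumes "real n \<le> p"
  shows "\<bar>x\<bar> ^ n \<le> 1 + \<bar>x\<bar> powr p"
proof (cases "\<bar>x\<bar> \<le> 1")
  case True
  then show ?thesis
    using power_le_one[of "\<bar>x\<bar>" n] powr_ge_zero[of "\<bar>x\<bar>" p] by linarith
next
  case False
  then have "\<bar>x\<bar> ^ n \<le> \<bar>x\<bar> powr p"
    using assms powr_mono[of "real n" p "\<bar>x\<bar>"] by (simp add: powr_realpow)
  then show ?thesis by simp
qed

text \<open>An elementary pointwise inequality does the work of Hoelder's: \<open>\<bar>x\<bar>
  \<le> d + d powr (1 - p) * \<bar>x\<bar> powr p\<close>. If the \<open>p\<close>-th mean is at
  most \<open>d powr p\<close>, both terms contribute at most \<open>d\<close>, hence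
  \<open>d = e / 2\<close>.\<close>

lemma besicovitch_ap_1:
  assumes f: "besicovitch_ap p f" and p: "p \<ge> 1"
  shows "besicovitch_ap 1 f"
  unfolding besicovitch_ap_def
proof (intro conjI allI impI)
  have [measurable]: "f \<in> borel_measurable lebesgue"
    using f by (rule besicovitch_ap_measurable)
  show "f \<in> borel_measurable lebesgue" by fact
  fix e :: real assume "e > 0"
  define d where "d = e / 2"
  have d: "d > 0"
    using \<open>e > 0\<close> by (simp add: d_def)
  obtain P D where P: "trig_poly (\<lambda>y. complex_of_real (P y))" and [measurable]: "P \<in> borel_measurable lebesgue"
    and ev: "\<forall>\<^sub>F Y in at_top. integrable (unif Y) (\<lambda>y. \<bar>f y - P y\<bar> powr p) \<and>
       (\<integral>y. \<bar>f y - P y\<bar> powr p \<partial>unif Y) \<le> d powr p"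
    by (rule besicovitch_apE[OF f, of "d powr p"]) (use d in simp)
  have le: "\<bar>x\<bar> powr 1 \<le> d + d powr (1 - p) * \<bar>x\<bar> powr p" for x
  proof (cases "\<bar>x\<bar> \<le> d")
    case True
    then show ?thesis by (simp add: add_increasing2)
  next
    case False
    then have "(\<bar>x\<bar> / d) powr 1 \<le> (\<bar>x\<bar> / d) powr p"
      using d p by (intro powr_mono) auto
    then have "\<bar>x\<bar> \<le> d * (\<bar>x\<bar> / d) powr p"
      using d by (simp add: field_simps)
    also have "\<dots> = d powr (1 - p) * \<bar>x\<bar> powr p"
      using d by (simp add: powr_divide powr_diff)
    finally show ?thesis
      using d by simp
  qed
  have "\<forall>\<^sub>F Y in at_top. integrable (unif Y) (\<lambda>y. \<bar>f y - P y\<bar> powr 1) \<and>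
       (\<integral>y. \<bar>f y - P y\<bar> powr 1 \<partial>unif Y) \<le> e"
    using ev eventually_gt_at_top[of "0::real"]
  proof eventually_elim
    case (elim Y)
    interpret prob_space "unif Y" by (rule prob_space_unif) fact
    let ?g = "\<lambda>y. d + d powr (1 - p) * \<bar>f y - P y\<bar> powr p"
    have int: "integrable (unif Y) ?g"
      using elim by simp
    have int1: "integrable (unif Y) (\<lambda>y. \<bar>f y - P y\<bar> powr 1)"
    proof (rule Bochner_Integration.integrable_bound[OF int])
      show "AE y in unif Y. norm (\<bar>f y - P y\<bar> powr 1) \<le> norm (?g y)"
        using le abs_ge_self order_trans by (fastforce intro: AE_I2)
    qed measurable
    have "(\<integral>y. \<bar>f y - P y\<bar> powr 1 \<partial>unif Y) \<le> (\<integral>y. ?g y \<partial>unif Y)"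
      by (rule integral_mono[OF int1 int le])
    also have "\<dots> = d + d powr (1 - p) * (\<integral>y. \<bar>f y - P y\<bar> powr p \<partial>unif Y)"
      using elim prob_space by simp
    also have "\<dots> \<le> d + d powr (1 - p) * d powr p"
      using elim by (intro add_left_mono mult_left_mono) auto
    also have "\<dots> = e"
      using d by (simp add: d_def flip: powr_add)
    finally show ?case
      using int1 by blast
  qed
  with P show "\<exists>P. trig_poly (\<lambda>y. complex_of_real (P y)) \<and>
        (\<forall>\<^sub>F Y in at_top. integrable (unif Y) (\<lambda>y. \<bar>f y - P y\<bar> powr 1) \<and>
           (\<integral>y. \<bar>f y - P y\<bar> powr 1 \<partial>unif Y) \<le> e)"
    by blast
qed

text \<open>Replacing \<open>f\<close> by an approximating \<open>P\<close> changes the mean by at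
  most \<open>L\<close> times the mean of \<open>\<bar>f y - P y\<bar>\<close>, and the mean of
  \<open>h (P y)\<close> converges. Boundedness of \<open>h\<close> makes both compositions
  integrable.\<close>

lemma besicovitch_ap_Lipschitz_mean:
  fixes h :: "real \<Rightarrow> real"
  assumes f: "besicovitch_ap 1 f" and L: "L > 0" "\<And>x y. \<bar>h x - h y\<bar> \<le> L * \<bar>x - y\<bar>"
    and B: "\<And>x. \<bar>h x\<bar> \<le> B"
  obtains m where "((\<lambda>Y. \<integral>y. h (f y) \<partial>unif Y) \<longlongrightarrow> m) at_top"
proof -
  have [measurable]: "f \<in> borel_measurable lebesgue"
    using f by (rule besicovitch_ap_measurable)
  have h: "continuous_on UNIV h"
    by (rule lipschitz_on_continuous_on[of L]) (use L in \<open>auto simp: lipschitz_on_def dist_real_def\<close>)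
  then have [measurable]: "h \<in> borel_measurable borel"
    by (rule borel_measurable_continuous_onI)
  have "\<exists>G m. (G \<longlongrightarrow> m) at_top \<and> (\<forall>\<^sub>F Y in at_top. dist (\<integral>y. h (f y) \<partial>unif Y) (G Y) \<le> e)"
    if "e > 0" for e
  proof -
    obtain P D where P: "trig_poly (\<lambda>y. complex_of_real (P y))" and [measurable]: "P \<in> borel_measurable lebesgue"
      and ev: "\<forall>\<^sub>F Y in at_top. integrable (unif Y) (\<lambda>y. \<bar>f y - P y\<bar> powr 1) \<and>
         (\<integral>y. \<bar>f y - P y\<bar> powr 1 \<partial>unif Y) \<le> e / L"
      by (rule besicovitch_apE[OF f, of "e / L"]) (use \<open>e > 0\<close> L(1) in simp)
    obtain m where m: "((\<lambda>Y. \<integral>y. h (P y) \<partial>unif Y) \<longlongrightarrow> m) at_top"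
      using trig_poly_compose_mean[OF P h] .
    have "\<forall>\<^sub>F Y in at_top. dist (\<integral>y. h (f y) \<partial>unif Y) (\<integral>y. h (P y) \<partial>unif Y) \<le> e"
      using ev eventually_gt_at_top[of "0::real"]
    proof eventually_elim
      case (elim Y)
      have int: "integrable (unif Y) (\<lambda>y. h (f y))" "integrable (unif Y) (\<lambda>y. h (P y))"
        using B elim by (auto intro!: integrable_unif_bounded[where B=B])
      have "\<bar>(\<integral>y. h (f y) \<partial>unif Y) - (\<integral>y. h (P y) \<partial>unif Y)\<bar> = \<bar>\<integral>y. h (f y) - h (P y) \<partial>unif Y\<bar>"
        using int by simp
      also have "\<dots> \<le> (\<integral>y. \<bar>h (f y) - h (P y)\<bar> \<partial>unif Y)"
        by (rule integral_abs_bound)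
      also have "\<dots> \<le> (\<integral>y. L * \<bar>f y - P y\<bar> powr 1 \<partial>unif Y)"
        using elim int L by (intro integral_mono) auto
      also have "\<dots> \<le> e"
        using elim L(1) by (simp add: field_simps)
      finally show ?case
        by (simp add: dist_real_def)
    qed
    with m show ?thesis by blast
  qed
  then obtain m where "((\<lambda>Y. \<integral>y. h (f y) \<partial>unif Y) \<longlongrightarrow> m) at_top"
    by (rule convergent_by_approximation)
  then show thesis
    by (rule that)
qed

section \<open>Characteristic functions and the weak limit\<close>

lemma besicovitch_ap_char:
  assumes f: "besicovitch_ap 1 f"
  obtains m where "((\<lambda>Y. char (distr (unif Y) borel f) t) \<longlongrightarrow> m) at_top"
proof -
  have [measurable]: "f \<in> borel_measurable lebesgue"
    using f by (rule besicovitch_ap_measurable)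
  \<comment> \<open>\<open>\<bar>t\<bar> + 1\<close> instead of \<open>\<bar>t\<bar>\<close>,
    because the Lipschitz constant must be positive also for \<open>t = 0\<close>.\<close>
  have "\<bar>cos (t * x) - cos (t * y)\<bar> \<le> (\<bar>t\<bar> + 1) * \<bar>x - y\<bar>" for x y
  proof -
    have "\<bar>cos (t * x) - cos (t * y)\<bar> = 2 * \<bar>sin ((t * x + t * y) / 2)\<bar> * \<bar>sin ((t * y - t * x) / 2)\<bar>"
      by (simp add: cos_diff_cos abs_mult)
    also have "\<dots> \<le> 2 * 1 * \<bar>(t * y - t * x) / 2\<bar>"
      by (intro mult_mono abs_sin_x_le_abs_x) auto
    also have "\<dots> = \<bar>t\<bar> * \<bar>x - y\<bar>"
      by (simp add: abs_mult[symmetric] right_diff_distrib)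
    finally show ?thesis by (simp add: distrib_right)
  qed
  then obtain a where a: "((\<lambda>Y. \<integral>y. cos (t * f y) \<partial>unif Y) \<longlongrightarrow> a) at_top"
    by (rule besicovitch_ap_Lipschitz_mean[OF f, of "\<bar>t\<bar> + 1" "\<lambda>x. cos (t * x)" 1, rotated]) auto
  have "\<bar>sin (t * x) - sin (t * y)\<bar> \<le> (\<bar>t\<bar> + 1) * \<bar>x - y\<bar>" for x y
  proof -
    have "\<bar>sin (t * x) - sin (t * y)\<bar> = 2 * \<bar>sin ((t * x - t * y) / 2)\<bar> * \<bar>cos ((t * x + t * y) / 2)\<bar>"
      by (simp add: sin_diff_sin abs_mult)
    also have "\<dots> \<le> 2 * \<bar>(t * x - t * y) / 2\<bar> * 1"
      by (intro mult_mono abs_sin_x_le_abs_x) auto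
    also have "\<dots> = \<bar>t\<bar> * \<bar>x - y\<bar>"
      by (simp add: abs_mult[symmetric] right_diff_distrib)
    finally show ?thesis by (simp add: distrib_right)
  qed
  then obtain b where b: "((\<lambda>Y. \<integral>y. sin (t * f y) \<partial>unif Y) \<longlongrightarrow> b) at_top"
    by (rule besicovitch_ap_Lipschitz_mean[OF f, of "\<bar>t\<bar> + 1" "\<lambda>x. sin (t * x)" 1, rotated]) auto
  have "\<forall>\<^sub>F Y in at_top. Complex (\<integral>y. cos (t * f y) \<partial>unif Y) (\<integral>y. sin (t * f y) \<partial>unif Y)
      = char (distr (unif Y) borel f) t"
    using eventually_gt_at_top[of "0::real"]
  proof eventually_elim
    case (elim Y)
    have int: "integrable (unif Y) (\<lambda>y. iexp (t * f y))"
      using elim by (intro integrable_unif_bounded[where B=1]) auto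
    have "char (distr (unif Y) borel f) t = (\<integral>y. iexp (t * f y) \<partial>unif Y)"
      unfolding char_def by (subst integral_distr) auto
    moreover have "Re (\<integral>y. iexp (t * f y) \<partial>unif Y) = (\<integral>y. cos (t * f y) \<partial>unif Y)"
      using integral_Re[OF int] by (simp add: Re_exp)
    moreover have "Im (\<integral>y. iexp (t * f y) \<partial>unif Y) = (\<integral>y. sin (t * f y) \<partial>unif Y)"
      using integral_Im[OF int] by (simp add: Im_exp)
    ultimately show ?case
      by (simp add: complex_eq_iff)
  qed
  then have "((\<lambda>Y. char (distr (unif Y) borel f) t) \<longlongrightarrow> Complex a b) at_top"
    using tendsto_Complex[OF a b] by (rule Lim_transform_eventually[rotated])
  then show thesis
    by (rule that)
qed

text \<open>Accuracy 1 suffices: the approximant is bounded by some \<open>D\<close>, so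
  \<open>f\<close> is a bounded function plus one with bounded \<open>p\<close>-th mean.\<close>

lemma besicovitch_ap_moment_bounded:
  assumes f: "besicovitch_ap p f" and p: "p \<ge> 0"
  obtains B where "\<forall>\<^sub>F Y in at_top. integrable (unif Y) (\<lambda>y. \<bar>f y\<bar> powr p) \<and>
       (\<integral>y. \<bar>f y\<bar> powr p \<partial>unif Y) \<le> B"
proof -
  have [measurable]: "f \<in> borel_measurable lebesgue"
    using f by (rule besicovitch_ap_measurable)
  obtain P D where "trig_poly (\<lambda>y. complex_of_real (P y))" and [measurable]: "P \<in> borel_measurable lebesgue"
    and "continuous_on UNIV P" and D: "D \<ge> 0" "\<And>y. \<bar>P y\<bar> \<le> D"
    and ev: "\<forall>\<^sub>F Y in at_top. integrable (unif Y) (\<lambda>y. \<bar>f y - P y\<bar> powr p) \<and>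
       (\<integral>y. \<bar>f y - P y\<bar> powr p \<partial>unif Y) \<le> 1"
    by (rule besicovitch_apE[OF f zero_less_one]) (rule that)
  have le: "\<bar>f y\<bar> powr p \<le> 2 powr p * (\<bar>f y - P y\<bar> powr p + D powr p)" for y
  proof -
    have "\<bar>f y\<bar> powr p \<le> (\<bar>f y - P y\<bar> + D) powr p"
      using D(2)[of y] p by (intro powr_mono2) auto
    also have "\<dots> \<le> 2 powr p * (\<bar>f y - P y\<bar> powr p + D powr p)"
      using D p by (intro powr_add_le_2) auto
    finally show ?thesis .
  qed
  have "\<forall>\<^sub>F Y in at_top. integrable (unif Y) (\<lambda>y. \<bar>f y\<bar> powr p) \<and>
       (\<integral>y. \<bar>f y\<bar> powr p \<partial>unif Y) \<le> 2 powr p * (1 + D powr p)"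
    using ev eventually_gt_at_top[of "0::real"]
  proof eventually_elim
    case (elim Y)
    interpret prob_space "unif Y" by (rule prob_space_unif) fact
    let ?g = "\<lambda>y. 2 powr p * (\<bar>f y - P y\<bar> powr p + D powr p)"
    have int: "integrable (unif Y) ?g"
      using elim by simp
    have int1: "integrable (unif Y) (\<lambda>y. \<bar>f y\<bar> powr p)"
    proof (rule Bochner_Integration.integrable_bound[OF int])
      show "AE y in unif Y. norm (\<bar>f y\<bar> powr p) \<le> norm (?g y)"
        using le by (intro AE_I2) simp
    qed measurable
    have "(\<integral>y. \<bar>f y\<bar> powr p \<partial>unif Y) \<le> (\<integral>y. ?g y \<partial>unif Y)"
      by (rule integral_mono[OF int1 int le])
    also have "\<dots> = 2 powr p * ((\<integral>y. \<bar>f y - P y\<bar> powr p \<partial>unif Y) + D powr p)"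
      using elim prob_space by simp
    also have "\<dots> \<le> 2 powr p * (1 + D powr p)"
      using elim by (intro mult_left_mono) auto
    finally show ?case
      using int1 by blast
  qed
  then show thesis
    by (rule that)
qed

text \<open>Markov's inequality for the first absolute moment gives tightness, hence a weak limit
  \<open>\<mu>\<close> along a subsequence. Because the characteristic functions converge as
  \<open>Y\<close> tends to infinity, their limit must be that of \<open>\<mu>\<close>, and Levy's
  theorem upgrades the subsequence to the full limit.\<close>

lemma besicovitch_ap_weak_limit:
  assumes f: "besicovitch_ap 1 f"
  obtains \<mu> where "real_distribution \<mu>"
    "\<And>g :: real \<Rightarrow> real. continuous_on UNIV g \<Longrightarrow> bounded (range g) \<Longrightarrow>
       ((\<lambda>Y. \<integral>y. g (f y) \<partial>unif Y) \<longlongrightarrow> (\<integral>x. g x \<partial>\<mu>)) at_top"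
proof -
  have [measurable]: "f \<in> borel_measurable lebesgue"
    using f by (rule besicovitch_ap_measurable)
  let ?\<nu> = "\<lambda>Y. distr (unif Y) borel f"
  have law: "real_distribution (?\<nu> Y)" if "Y > 0" for Y
    using that by (intro prob_space.real_distribution_distr prob_space_unif) auto
  obtain B where "\<forall>\<^sub>F Y in at_top. integrable (unif Y) (\<lambda>y. \<bar>f y\<bar> powr 1) \<and>
       (\<integral>y. \<bar>f y\<bar> powr 1 \<partial>unif Y) \<le> B"
    by (rule besicovitch_ap_moment_bounded[OF f zero_le_one])
  then obtain Y1 where Y1: "\<And>Y. Y \<ge> Y1 \<Longrightarrow> integrable (unif Y) (\<lambda>y. \<bar>f y\<bar>) \<and>
       (\<integral>y. \<bar>f y\<bar> \<partial>unif Y) \<le> B"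
    unfolding eventually_at_top_linorder by auto
  define S where "S n = max 1 Y1 + real n" for n :: nat
  have S: "S n > 0" "S n \<ge> Y1" for n
    by (auto simp: S_def)
  have S_top: "filterlim S at_top sequentially"
    unfolding S_def
    by (intro filterlim_tendsto_add_at_top[OF tendsto_const] filterlim_real_sequentially)
  have "tight (\<lambda>n. ?\<nu> (S n))"
    unfolding tight_def
  proof (intro conjI allI impI)
    show "real_distribution (?\<nu> (S n))" for n
      using S by (intro law)
    fix e :: real assume "e > 0"
    \<comment> \<open>The summand 1 keeps \<open>R\<close> positive for \<open>B = 0\<close> and
      makes \<open>\<bar>B\<bar> / R < e\<close> strict.\<close>
    define R where "R = (\<bar>B\<bar> + 1) / e"
    have "R > 0"
      using \<open>e > 0\<close> by (simp add: R_def)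
    have "measure (?\<nu> (S n)) {-R<..R} > 1 - e" for n
    proof -
      interpret U: prob_space "unif (S n)" using S by (intro prob_space_unif)
      interpret N: real_distribution "?\<nu> (S n)" using S by (intro law)
      have "measure (unif (S n)) {y \<in> space (unif (S n)). R \<le> \<bar>f y\<bar>} \<le> (\<integral>y. \<bar>f y\<bar> \<partial>unif (S n)) / R"
        using Y1[OF S(2)] \<open>R > 0\<close> by (intro integral_Markov_inequality_measure[where A="{}"]) auto
      also have "\<dots> \<le> \<bar>B\<bar> / R"
        using Y1[OF S(2)[of n]] \<open>R > 0\<close> by (intro divide_right_mono) auto
      also have "\<dots> < e"
        using \<open>e > 0\<close> by (simp add: R_def field_simps)
      finally have "measure (unif (S n)) {y. R \<le> \<bar>f y\<bar>} < e"
        by simp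
      moreover have "measure (?\<nu> (S n)) (UNIV - {-R<..R}) \<le> measure (unif (S n)) {y. R \<le> \<bar>f y\<bar>}"
      proof -
        have "{y \<in> space lebesgue. R \<le> \<bar>f y\<bar>} \<in> sets lebesgue"
          by measurable
        then have "{y. R \<le> \<bar>f y\<bar>} \<in> sets (unif (S n))"
          by simp
        then show ?thesis
          by (subst measure_distr) (auto intro!: U.finite_measure_mono)
      qed
      ultimately show ?thesis
        using N.prob_compl[of "{-R<..R}"] by simp
    qed
    then show "\<exists>a b. a < b \<and> (\<forall>n. 1 - e < measure (?\<nu> (S n)) {a<..b})"
      using \<open>R > 0\<close> by (intro exI[of _ "-R"] exI[of _ R]) auto
  qed
  from tight_imp_convergent_subsubsequence[OF this strict_mono_id] obtain s \<mu> where
    s: "strict_mono (s :: nat \<Rightarrow> nat)" and \<mu>: "real_distribution \<mu>"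
    and conv: "weak_conv_m (\<lambda>n. ?\<nu> (S (s n))) \<mu>"
    by (auto simp: comp_def)
  have char_lim: "((\<lambda>Y. char (?\<nu> Y) t) \<longlongrightarrow> char \<mu> t) at_top" for t
  proof -
    obtain m where m: "((\<lambda>Y. char (?\<nu> Y) t) \<longlongrightarrow> m) at_top"
      using besicovitch_ap_char[OF f] .
    have "(\<lambda>n. char (?\<nu> (S (s n))) t) \<longlonglongrightarrow> m"
      by (intro filterlim_compose[OF m] filterlim_compose[OF S_top] filterlim_subseq s)
    moreover have "(\<lambda>n. char (?\<nu> (S (s n))) t) \<longlonglongrightarrow> char \<mu> t"
      using levy_continuity1[OF _ \<mu> conv] law S by simp
    ultimately have "m = char \<mu> t"
      using LIMSEQ_unique by blast
    with m show ?thesis by simp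
  qed
  show thesis
  proof (rule that[OF \<mu>], rule tendsto_at_topI_sequentially)
    fix g :: "real \<Rightarrow> real" and X :: "nat \<Rightarrow> real"
    assume g: "continuous_on UNIV g" "bounded (range g)" and X: "filterlim X at_top sequentially"
    from g(2) obtain C where C: "\<And>x. norm (g x) \<le> C"
      by (auto simp: bounded_iff)
    have [measurable]: "g \<in> borel_measurable borel"
      using g(1) by (rule borel_measurable_continuous_onI)
    \<comment> \<open>Clipping at 1 changes only finitely many terms and makes
      \<open>unif (Z n)\<close> a probability measure for every index, as Levy's theorem
      requires.\<close>
    define Z where "Z n = max 1 (X n)" for n
    have ev: "\<forall>\<^sub>F n in sequentially. Z n = X n"
      using filterlim_at_top_ge X by (auto simp: Z_def filterlim_at_top elim!: eventually_mono dest!: spec[of _ 1])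
    have Z: "filterlim Z at_top sequentially"
      using X by (rule filterlim_at_top_mono) (auto simp: Z_def)
    have Z0: "Z n > 0" for n
      by (simp add: Z_def)
    have "weak_conv_m (\<lambda>n. ?\<nu> (Z n)) \<mu>"
      by (intro levy_continuity law Z0 \<mu> filterlim_compose[OF char_lim Z])
    then have "(\<lambda>n. \<integral>x. g x \<partial>?\<nu> (Z n)) \<longlonglongrightarrow> (\<integral>x. g x \<partial>\<mu>)"
      using law[OF Z0] \<mu> g(1) C
      by (intro weak_conv_imp_integral_bdd_continuous_conv[where B=C]) (auto simp: continuous_on_eq_continuous_at)
    then have "(\<lambda>n. \<integral>y. g (f y) \<partial>unif (Z n)) \<longlonglongrightarrow> (\<integral>x. g x \<partial>\<mu>)"
      by (simp add: integral_distr)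
    then show "(\<lambda>n. \<integral>y. g (f y) \<partial>unif (X n)) \<longlonglongrightarrow> (\<integral>x. g x \<partial>\<mu>)"
      by (rule Lim_transform_eventually) (use ev in \<open>auto elim!: eventually_mono\<close>)
  qed
qed

section \<open>Truncation and convergence of moments\<close>

definition truncate :: "real \<Rightarrow> real \<Rightarrow> real" where
  "truncate R x = max (- R) (min R x)"

lemma continuous_on_truncate: "continuous_on UNIV (truncate R)"
  unfolding truncate_def by (intro continuous_intros)

lemma abs_truncate_le: "R \<ge> 0 \<Longrightarrow> \<bar>truncate R x\<bar> \<le> R" "R \<ge> 0 \<Longrightarrow> \<bar>truncate R x\<bar> \<le> \<bar>x\<bar>"
  by (auto simp: truncate_def)

lemma truncate_id: "\<bar>x\<bar> \<le> R \<Longrightarrow> truncate R x = x"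
  by (auto simp: truncate_def)

lemma bounded_truncate_power: "R \<ge> 0 \<Longrightarrow> bounded (range (\<lambda>x. truncate R x ^ n))"
  by (auto simp: bounded_iff power_abs intro!: exI[of _ "R ^ n"] power_mono abs_truncate_le)

lemma tendsto_truncate: "(\<lambda>k. truncate (real k) x) \<longlonglongrightarrow> x"
proof (rule tendsto_eventually)
  show "\<forall>\<^sub>F k in sequentially. truncate (real k) x = x"
    using filterlim_real_sequentially[unfolded filterlim_at_top, rule_format, of "\<bar>x\<bar>"]
    by eventually_elim (rule truncate_id)
qed

lemma besicovitch_ap_power_integrable:
  assumes f: "besicovitch_ap p f" and n: "real n \<le> p"
  shows "\<forall>\<^sub>F Y in at_top. integrable (unif Y) (\<lambda>y. f y ^ n)"
proof -
  have [measurable]: "f \<in> borel_measurable lebesgue"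
    using f by (rule besicovitch_ap_measurable)
  have "p \<ge> 0"
    using n of_nat_0_le_iff order_trans by blast
  obtain B where "\<forall>\<^sub>F Y in at_top. integrable (unif Y) (\<lambda>y. \<bar>f y\<bar> powr p) \<and>
       (\<integral>y. \<bar>f y\<bar> powr p \<partial>unif Y) \<le> B"
    by (rule besicovitch_ap_moment_bounded[OF f \<open>p \<ge> 0\<close>])
  then show ?thesis
    using eventually_gt_at_top[of "0::real"]
  proof eventually_elim
    case (elim Y)
    interpret prob_space "unif Y" by (rule prob_space_unif) fact
    have "integrable (unif Y) (\<lambda>y. 1 + \<bar>f y\<bar> powr p)"
      using elim by simp
    then show ?case
    proof (rule Bochner_Integration.integrable_bound)
      show "AE y in unif Y. norm (f y ^ n) \<le> norm (1 + \<bar>f y\<bar> powr p)"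
        using power_le_one_plus_powr[OF n] by (intro AE_I2) (simp add: power_abs)
    qed measurable
  qed
qed

text \<open>Truncation changes \<open>f\<close> only where it is large compared with the bounded
  approximant \<open>P\<close>. There \<open>f - P\<close> is large as well, so the mean of
  \<open>\<bar>f y - P y\<bar> powr p\<close> controls the error. The threshold depends on
  \<open>P\<close> but not on \<open>Y\<close>.\<close>

lemma besicovitch_ap_uniformly_integrable:
  assumes f: "besicovitch_ap p f" and n: "real n \<le> p" and "e > 0"
  obtains R0 where "R0 \<ge> 0"
    "\<And>R. R \<ge> R0 \<Longrightarrow> \<forall>\<^sub>F Y in at_top. \<bar>(\<integral>y. f y ^ n \<partial>unif Y) - (\<integral>y. truncate R (f y) ^ n \<partial>unif Y)\<bar> \<le> e"
proof -
  have [measurable]: "f \<in> borel_measurable lebesgue"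
    using f by (rule besicovitch_ap_measurable)
  have p: "p \<ge> 0"
    using n by (meson of_nat_0_le_iff order_trans)
  \<comment> \<open>Compensates the pointwise factor \<open>2 * 2 powr p\<close> in
    \<open>le\<close> below.\<close>
  define d where "d = e / (2 * 2 powr p)"
  have "d > 0"
    using \<open>e > 0\<close> by (simp add: d_def)
  obtain P D where "trig_poly (\<lambda>y. complex_of_real (P y))" and [measurable]: "P \<in> borel_measurable lebesgue"
    and "continuous_on UNIV P" and D: "D \<ge> 0" "\<And>y. \<bar>P y\<bar> \<le> D"
    and ev: "\<forall>\<^sub>F Y in at_top. integrable (unif Y) (\<lambda>y. \<bar>f y - P y\<bar> powr p) \<and>
       (\<integral>y. \<bar>f y - P y\<bar> powr p \<partial>unif Y) \<le> d"
    by (rule besicovitch_apE[OF f \<open>d > 0\<close>]) (rule that)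
  show thesis
  proof (rule that)
    \<comment> \<open>Beyond \<open>2 * D\<close> one has
      \<open>\<bar>f y\<bar> \<le> 2 * \<bar>f y - P y\<bar>\<close>; the extra 1 gives
      \<open>\<bar>f y\<bar> > 1\<close>, so that its \<open>n\<close>-th power is at most its
      \<open>p\<close>-th.\<close>
    show "2 * D + 1 \<ge> 0"
      using D by simp
    fix R assume R: "R \<ge> 2 * D + 1"
    have [measurable]: "truncate R \<in> borel_measurable borel"
      by (rule borel_measurable_continuous_onI[OF continuous_on_truncate])
    have le: "\<bar>f y ^ n - truncate R (f y) ^ n\<bar> \<le> 2 * 2 powr p * \<bar>f y - P y\<bar> powr p" for y
    proof (cases "\<bar>f y\<bar> \<le> R")
      case True
      then show ?thesis by (simp add: truncate_id)
    next
      case False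
      then have le2: "\<bar>f y\<bar> \<le> 2 * \<bar>f y - P y\<bar>"
        using R D(1) D(2)[of y] abs_triangle_ineq2[of "f y" "P y"] by argo
      have "\<bar>f y ^ n - truncate R (f y) ^ n\<bar> \<le> \<bar>f y\<bar> ^ n + \<bar>truncate R (f y)\<bar> ^ n"
        using abs_triangle_ineq4[of "f y ^ n" "truncate R (f y) ^ n"] by (simp add: power_abs)
      also have "\<dots> \<le> \<bar>f y\<bar> ^ n + \<bar>f y\<bar> ^ n"
        using R D by (intro add_left_mono power_mono abs_truncate_le) auto
      also have "\<dots> = 2 * \<bar>f y\<bar> powr real n"
        using False R D by (simp add: powr_realpow)
      also have "\<dots> \<le> 2 * \<bar>f y\<bar> powr p"
        using False R D n by (intro mult_left_mono powr_mono) auto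
      also have "\<dots> \<le> 2 * (2 * \<bar>f y - P y\<bar>) powr p"
        using le2 p by (intro mult_left_mono powr_mono2) auto
      finally show ?thesis
        by (simp add: powr_mult)
    qed
    show "\<forall>\<^sub>F Y in at_top. \<bar>(\<integral>y. f y ^ n \<partial>unif Y) - (\<integral>y. truncate R (f y) ^ n \<partial>unif Y)\<bar> \<le> e"
      using ev besicovitch_ap_power_integrable[OF f n] eventually_gt_at_top[of "0::real"]
    proof eventually_elim
      case (elim Y)
      have int: "integrable (unif Y) (\<lambda>y. truncate R (f y) ^ n)"
        using R D elim
        by (intro integrable_unif_bounded[where B="R ^ n"]) (auto simp: power_abs intro!: power_mono abs_truncate_le)
      have "\<bar>(\<integral>y. f y ^ n \<partial>unif Y) - (\<integral>y. truncate R (f y) ^ n \<partial>unif Y)\<bar>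
          = \<bar>\<integral>y. f y ^ n - truncate R (f y) ^ n \<partial>unif Y\<bar>"
        using int elim by simp
      also have "\<dots> \<le> (\<integral>y. \<bar>f y ^ n - truncate R (f y) ^ n\<bar> \<partial>unif Y)"
        by (rule integral_abs_bound)
      also have "\<dots> \<le> (\<integral>y. 2 * 2 powr p * \<bar>f y - P y\<bar> powr p \<partial>unif Y)"
        using elim int le by (intro integral_mono) auto
      also have "\<dots> \<le> 2 * 2 powr p * d"
        using elim by simp
      also have "\<dots> = e"
        by (simp add: d_def)
      finally show ?case .
    qed
  qed
qed

text \<open>Integrability under \<open>\<mu>\<close> comes first: truncated absolute moments pass to
  the weak limit with a common bound, and monotone convergence removes the truncation. The
  difference of the moments is then split in three: truncation error of the means, weak convergence
  of the truncated power, truncation error under \<open>\<mu>\<close>.\<close>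

lemma besicovitch_ap_moments:
  assumes f: "besicovitch_ap p f" and n: "real n \<le> p"
    and \<mu>: "real_distribution \<mu>"
    and lim: "\<And>g :: real \<Rightarrow> real. continuous_on UNIV g \<Longrightarrow> bounded (range g) \<Longrightarrow>
       ((\<lambda>Y. \<integral>y. g (f y) \<partial>unif Y) \<longlongrightarrow> (\<integral>x. g x \<partial>\<mu>)) at_top"
  shows "integrable \<mu> (\<lambda>x. x ^ n)"
    and "((\<lambda>Y. \<integral>y. f y ^ n \<partial>unif Y) \<longlongrightarrow> (\<integral>x. x ^ n \<partial>\<mu>)) at_top"
proof -
  interpret \<mu>: real_distribution \<mu> by fact
  have [measurable]: "f \<in> borel_measurable lebesgue"
    using f by (rule besicovitch_ap_measurable)
  have [measurable]: "truncate R \<in> borel_measurable borel" for R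
    by (rule borel_measurable_continuous_onI[OF continuous_on_truncate])
  have p: "p \<ge> 0"
    using n by (meson of_nat_0_le_iff order_trans)
  \<comment> \<open>Absolute values make these functions increase with \<open>k\<close>; being
    bounded and continuous, they are admissible test functions.\<close>
  let ?a = "\<lambda>k x. \<bar>truncate (real k) x\<bar> ^ n"
  obtain B where B: "\<forall>\<^sub>F Y in at_top. integrable (unif Y) (\<lambda>y. \<bar>f y\<bar> powr p) \<and>
       (\<integral>y. \<bar>f y\<bar> powr p \<partial>unif Y) \<le> B"
    using besicovitch_ap_moment_bounded[OF f p] .
  have int_a: "integrable \<mu> (?a k)" for k
    by (intro \<mu>.integrable_const_bound[where B="real k ^ n"]) (auto intro!: power_mono abs_truncate_le)
  have le: "(\<integral>x. ?a k x \<partial>\<mu>) \<le> 1 + B" for k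
  proof (rule tendsto_upperbound)
    show "((\<lambda>Y. \<integral>y. ?a k (f y) \<partial>unif Y) \<longlongrightarrow> (\<integral>x. ?a k x \<partial>\<mu>)) at_top"
      using bounded_truncate_power[of "real k" n]
      by (intro lim continuous_intros continuous_on_truncate) (simp add: bounded_iff power_abs)
    show "\<forall>\<^sub>F Y in at_top. (\<integral>y. ?a k (f y) \<partial>unif Y) \<le> 1 + B"
      using B eventually_gt_at_top[of "0::real"]
    proof eventually_elim
      case (elim Y)
      interpret prob_space "unif Y" by (rule prob_space_unif) fact
      have "(\<integral>y. ?a k (f y) \<partial>unif Y) \<le> (\<integral>y. 1 + \<bar>f y\<bar> powr p \<partial>unif Y)"
      proof (rule integral_mono)
        show "integrable (unif Y) (\<lambda>y. ?a k (f y))"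
          using elim
          by (intro integrable_unif_bounded[where B="real k ^ n"]) (auto intro!: power_mono abs_truncate_le)
        show "?a k (f y) \<le> 1 + \<bar>f y\<bar> powr p" for y
          using power_mono[OF abs_truncate_le(2)[of "real k" "f y"], of n] power_le_one_plus_powr[OF n, of "f y"] by simp
      qed (use elim in simp)
      also have "\<dots> \<le> 1 + B"
        using elim prob_space by simp
      finally show ?case .
    qed
  qed simp
  have mono: "?a k x \<le> ?a l x" if "k \<le> l" for k l x
    using that by (intro power_mono) (auto simp: truncate_def)
  have "incseq (\<lambda>k. \<integral>x. ?a k x \<partial>\<mu>)"
    using int_a mono by (intro monoI integral_mono) auto
  then obtain L where L: "(\<lambda>k. \<integral>x. ?a k x \<partial>\<mu>) \<longlonglongrightarrow> L"
    using incseq_convergent le by metis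
  have "integrable \<mu> (\<lambda>x. \<bar>x\<bar> ^ n)"
  proof (rule integrable_monotone_convergence[OF int_a _ _ L])
    show "AE x in \<mu>. mono (\<lambda>k. ?a k x)"
      using mono by (intro AE_I2 monoI) auto
    show "AE x in \<mu>. (\<lambda>k. ?a k x) \<longlonglongrightarrow> \<bar>x\<bar> ^ n"
      by (intro AE_I2 tendsto_intros tendsto_truncate)
  qed simp
  then show int: "integrable \<mu> (\<lambda>x. x ^ n)"
    by (rule Bochner_Integration.integrable_bound) (auto simp: power_abs)
  have trunc_lim: "(\<lambda>k. \<integral>x. truncate (real k) x ^ n \<partial>\<mu>) \<longlonglongrightarrow> (\<integral>x. x ^ n \<partial>\<mu>)"
  proof (rule integral_dominated_convergence[where w="\<lambda>x. \<bar>x\<bar> ^ n"])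
    show "AE x in \<mu>. norm (truncate (real k) x ^ n) \<le> \<bar>x\<bar> ^ n" for k
      by (auto simp: power_abs intro!: power_mono abs_truncate_le)
  qed (use \<open>integrable \<mu> (\<lambda>x. \<bar>x\<bar> ^ n)\<close> in \<open>auto intro!: tendsto_intros tendsto_truncate\<close>)
  show "((\<lambda>Y. \<integral>y. f y ^ n \<partial>unif Y) \<longlongrightarrow> (\<integral>x. x ^ n \<partial>\<mu>)) at_top"
  proof (rule tendstoI)
    fix e :: real assume "e > 0"
    then obtain R0 where "R0 \<ge> 0" and R0: "\<And>R. R \<ge> R0 \<Longrightarrow>
        \<forall>\<^sub>F Y in at_top. \<bar>(\<integral>y. f y ^ n \<partial>unif Y) - (\<integral>y. truncate R (f y) ^ n \<partial>unif Y)\<bar> \<le> e/3"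
      using besicovitch_ap_uniformly_integrable[OF f n, of "e/3"] by auto
    have "\<forall>\<^sub>F k in sequentially. R0 \<le> real k"
      using filterlim_real_sequentially by (simp add: filterlim_at_top)
    moreover have "\<forall>\<^sub>F k in sequentially. dist (\<integral>x. truncate (real k) x ^ n \<partial>\<mu>) (\<integral>x. x ^ n \<partial>\<mu>) < e/3"
      using \<open>e > 0\<close> by (intro tendstoD[OF trunc_lim]) auto
    \<comment> \<open>One cut-off \<open>k\<close> serves both truncation errors; \<open>Y\<close>
      is taken large afterwards.\<close>
    ultimately have "\<exists>k. R0 \<le> real k \<and> dist (\<integral>x. truncate (real k) x ^ n \<partial>\<mu>) (\<integral>x. x ^ n \<partial>\<mu>) < e/3"
      by (intro eventually_happens'[OF sequentially_bot] eventually_conj)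
    then obtain k where k: "R0 \<le> real k" "dist (\<integral>x. truncate (real k) x ^ n \<partial>\<mu>) (\<integral>x. x ^ n \<partial>\<mu>) < e/3"
      by blast
    have "((\<lambda>Y. \<integral>y. truncate (real k) (f y) ^ n \<partial>unif Y) \<longlongrightarrow> (\<integral>x. truncate (real k) x ^ n \<partial>\<mu>)) at_top"
      by (intro lim continuous_intros continuous_on_truncate bounded_truncate_power) simp
    then have "\<forall>\<^sub>F Y in at_top. dist (\<integral>y. truncate (real k) (f y) ^ n \<partial>unif Y) (\<integral>x. truncate (real k) x ^ n \<partial>\<mu>) < e/3"
      using \<open>e > 0\<close> by (intro tendstoD) auto
    with R0[OF k(1)] show "\<forall>\<^sub>F Y in at_top. dist (\<integral>y. f y ^ n \<partial>unif Y) (\<integral>x. x ^ n \<partial>\<mu>) < e"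
    proof eventually_elim
      case (elim Y)
      then show ?case
        using k(2) unfolding dist_real_def by linarith
    qed
  qed
qed

section \<open>Functions with a \<open>(p,\<beta>)\<close> expansion\<close>

text \<open>Serves the pieces of the approximation error that live on a subinterval of
  \<open>[0, Y]\<close>. For a fixed \<open>g\<close> it shows that the mean is a constant divided
  by \<open>Y\<close>.\<close>

lemma unif_supported:
  fixes g :: "real \<Rightarrow> real"
  assumes g: "integrable lebesgue g" and supp: "\<And>y. y \<notin> {0..Y} \<Longrightarrow> g y = 0" and Y: "Y > 0"
  shows "integrable (unif Y) g" "(\<integral>y. g y \<partial>unif Y) = (1/Y) * (\<integral>y. g y \<partial>lebesgue)"
proof -
  have eq: "(\<lambda>y. indicator {0..Y} y * g y) = g"
    by (rule ext) (use supp in \<open>simp split: split_indicator\<close>)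
  have meas: "g \<in> borel_measurable lebesgue"
    using g by (rule borel_measurable_integrable)
  show "integrable (unif Y) g"
    using g Y by (simp add: integrable_unif[OF meas] set_integrable_def eq)
  show "(\<integral>y. g y \<partial>unif Y) = (1/Y) * (\<integral>y. g y \<partial>lebesgue)"
    using integral_unif[OF meas Y] by (simp add: set_lebesgue_integral_def eq)
qed

text \<open>\<open>\<phi>\<close> is only measurable on \<open>[0,\<infinity>)\<close>, hence the cut-off.\<close>

lemma p_beta_function_besicovitch_ap:
  assumes p: "p \<ge> 2" and \<beta>: "\<beta> > 1 - 1 / p" and \<phi>: "p_beta_function p \<beta> \<phi>"
  shows "besicovitch_ap p (\<lambda>y. indicator {0..} y * \<phi> y)" (is "besicovitch_ap p ?f")
proof -
  from \<phi> obtain lam r C T0 where pf: "p_function_with p \<phi> lam r" and C: "C > 0" and "T0 > 0"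
    and win: "\<And>T. T \<ge> T0 \<Longrightarrow> (\<Sum>n | T \<le> lam n \<and> lam n \<le> T + 1. norm (r n)) \<le> C * T powr (- \<beta>)"
    unfolding p_beta_function_def by blast
  from pf have meas: "?f \<in> borel_measurable lebesgue" and lam0: "\<And>n. lam n > 0"
    and lam: "filterlim lam at_top sequentially"
    by (auto simp: p_function_with_def set_borel_measurable_def)
  from pf obtain y0 X0 E XX where y0: "y0 > 0" and "X0 > 0"
    and int0: "set_integrable lebesgue {0..y0} (\<lambda>y. \<bar>\<phi> y\<bar> powr p)"
    and rep: "\<And>y X. y \<ge> y0 \<Longrightarrow> X \<ge> X0 \<Longrightarrow> \<phi> y = 2 * Re (\<Sum>n | 0 < lam n \<and> lam n \<le> X.
                r n * exp (\<i> * complex_of_real (lam n * y))) + E y X"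
    and XX: "filterlim XX at_top at_top"
    and intE: "\<forall>\<^sub>F Y in at_top. set_integrable lebesgue {y0..Y} (\<lambda>y. \<bar>E y (XX Y)\<bar> powr p)"
    and limE: "((\<lambda>Y. 1 / Y * (LINT y:{y0..Y}|lebesgue. \<bar>E y (XX Y)\<bar> powr p)) \<longlongrightarrow> 0) at_top"
    unfolding p_function_with_def by blast
  have "1 / p \<le> 1"
    using p by simp
  then have "\<beta> \<ge> 0"
    using \<beta> by linarith
  \<comment> \<open>Positivity of the decay exponent \<open>1 - p * (1 - \<beta>)\<close>,
    equivalent to \<open>\<beta> > 1 - 1 / p\<close>.\<close>
  have \<theta>: "p * (1 - \<beta>) < 1"
    using \<beta> p by (simp add: field_simps)
  have fin: "finite {n. lam n \<le> X}" for X
  proof -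
    obtain N where "\<And>n. n \<ge> N \<Longrightarrow> X < lam n"
      using lam by (auto simp: filterlim_at_top_dense eventually_sequentially)
    then have "{n. lam n \<le> X} \<subseteq> {..<N}"
      by (auto simp: not_le[symmetric])
    then show ?thesis
      using finite_subset by blast
  qed
  obtain q K where q: "0 < q" "q < 1" and tail:
    "\<forall>J A Y. T0 \<le> 2 ^ J \<longrightarrow> finite A \<longrightarrow> (\<forall>n\<in>A. 2 ^ J < lam n) \<longrightarrow> Y \<ge> 1 \<longrightarrow>
      (\<integral>y. norm (exp_sum lam r A y) powr p \<partial>unif Y) \<le> K * q ^ J"
    by (rule mean_powr_exp_sum_tail[OF fin _ less_imp_le[OF C] \<open>\<beta> \<ge> 0\<close> p \<theta>]) (erule win, rule that)
  show ?thesis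
    unfolding besicovitch_ap_def
  proof (intro conjI allI impI meas)
    fix e :: real assume "e > 0"
    \<comment> \<open>The factor \<open>4 powr p\<close> is \<open>2 powr p\<close> from separating
      the error term times \<open>2 powr p\<close> from the 2 in front of the real part.\<close>
    have "(\<lambda>J. 4 powr p * (K * q ^ J)) \<longlonglongrightarrow> 4 powr p * (K * 0)"
      using q by (intro tendsto_intros LIMSEQ_realpow_zero) auto
    then have "\<forall>\<^sub>F J in sequentially. 4 powr p * (K * q ^ J) < e / 2"
      by (rule order_tendstoD(2)) (use \<open>e > 0\<close> in simp)
    moreover have "\<forall>\<^sub>F J in sequentially. T0 \<le> 2 ^ J"
    proof -
      obtain N where N: "T0 < 2 ^ N"
        using real_arch_pow[of 2 T0] by auto
      show ?thesis
        using eventually_ge_at_top[of N]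
      proof eventually_elim
        case (elim J)
        then have "(2::real) ^ N \<le> 2 ^ J"
          by (intro power_increasing) auto
        with N show ?case by linarith
      qed
    qed
    ultimately have "\<exists>J. 4 powr p * (K * q ^ J) < e / 2 \<and> T0 \<le> 2 ^ J"
      by (intro eventually_happens'[OF sequentially_bot] eventually_conj)
    then obtain J where J: "4 powr p * (K * q ^ J) < e / 2" "T0 \<le> 2 ^ J"
      by blast
    \<comment> \<open>The head of the expansion serves as approximant: it is fixed, whereas the
      cut-off \<open>XX Y\<close> moves with \<open>Y\<close>.\<close>
    define A0 where "A0 = {n. lam n \<le> 2 ^ J}"
    define P where "P y = 2 * Re (exp_sum lam r A0 y)" for y
    have A0: "finite A0"
      using fin by (simp add: A0_def)
    \<comment> \<open>Twice the real part is the sum with the conjugate, whose frequencies are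
      \<open>- lam n\<close>; this exhibits \<open>P\<close> as a trigonometric polynomial.\<close>
    have cnj: "cnj (exp_sum lam r A0 y) = exp_sum (\<lambda>n. - lam n) (\<lambda>n. cnj (r n)) A0 y" for y
      by (simp add: exp_sum_def exp_cnj)
    have "complex_of_real (P y) = exp_sum lam r A0 y + exp_sum (\<lambda>n. - lam n) (\<lambda>n. cnj (r n)) A0 y" for y
      unfolding cnj[symmetric] P_def by (simp add: complex_add_cnj)
    then have trigP: "trig_poly (\<lambda>y. complex_of_real (P y))"
      using A0 by (simp add: trig_poly.add trig_poly_exp_sum)
    have contP: "continuous_on UNIV P"
      unfolding P_def by (intro continuous_intros)
    obtain D where "\<And>y. norm (complex_of_real (P y)) \<le> D"
      by (rule trig_poly_bounded[OF trigP]) (rule that)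
    then have D: "\<bar>P y\<bar> \<le> D" for y
      by simp
    have "D \<ge> 0"
      using D[of 0] by linarith
    let ?d = "\<lambda>y. \<bar>?f y - P y\<bar> powr p"
    have d_meas: "?d \<in> borel_measurable lebesgue"
      by (rule measurable_compose[OF borel_measurable_diff[OF meas borel_measurable_lebesgue_continuous[OF contP]]]) measurable
    define h1 where "h1 y = indicator {0..y0} y * ?d y" for y
    define c where "c = (\<integral>y. h1 y \<partial>lebesgue)"
    have int1: "integrable lebesgue h1"
    proof (rule Bochner_Integration.integrable_bound)
      show "integrable lebesgue (\<lambda>y. 2 powr p * (indicator {0..y0} y *\<^sub>R \<bar>\<phi> y\<bar> powr p + D powr p * indicator {0..y0} y))"
        using int0 y0 by (intro integrable_mult_right Bochner_Integration.integrable_add integrable_real_indicator)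
          (auto simp: set_integrable_def simp del: real_scaleR_def)
      show "AE y in lebesgue. norm (h1 y) \<le> norm (2 powr p * (indicator {0..y0} y *\<^sub>R \<bar>\<phi> y\<bar> powr p + D powr p * indicator {0..y0} y))"
      proof (intro AE_I2)
        fix y
        have "\<bar>\<phi> y - P y\<bar> powr p \<le> (\<bar>\<phi> y\<bar> + D) powr p"
          using D[of y] p by (intro powr_mono2) auto
        also have "\<dots> \<le> 2 powr p * (\<bar>\<phi> y\<bar> powr p + D powr p)"
          using \<open>D \<ge> 0\<close> p by (intro powr_add_le_2) auto
        finally show "norm (h1 y) \<le> norm (2 powr p * (indicator {0..y0} y *\<^sub>R \<bar>\<phi> y\<bar> powr p + D powr p * indicator {0..y0} y))"
          by (auto simp: h1_def indicator_def)
      qed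
      show "h1 \<in> borel_measurable lebesgue"
        unfolding h1_def by (intro borel_measurable_times borel_measurable_indicator d_meas) auto
    qed
    have lim1: "((\<lambda>Y. 1 / Y * c) \<longlongrightarrow> 0) at_top"
      by (intro tendsto_mult_left_zero tendsto_divide_0[OF tendsto_const])
         (auto intro: filterlim_at_top_imp_at_infinity filterlim_ident)
    have "\<forall>\<^sub>F Y in at_top. 1 / Y * c < e / 4"
      by (rule order_tendstoD(2)[OF lim1]) (use \<open>e > 0\<close> in simp)
    moreover have "\<forall>\<^sub>F Y in at_top. 2 powr p * (1 / Y * (LINT y:{y0..Y}|lebesgue. \<bar>E y (XX Y)\<bar> powr p)) < e / 4"
      by (rule order_tendstoD(2)[OF tendsto_mult_right_zero[OF limE]]) (use \<open>e > 0\<close> in simp)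
    \<comment> \<open>\<open>X0\<close> makes the expansion valid at \<open>X = XX Y\<close>, and
      \<open>2 ^ J\<close> makes its range contain \<open>A0\<close>.\<close>
    moreover have "\<forall>\<^sub>F Y in at_top. max X0 (2 ^ J) \<le> XX Y"
      using XX unfolding filterlim_at_top by blast
    ultimately have "\<forall>\<^sub>F Y in at_top. integrable (unif Y) ?d \<and> (\<integral>y. ?d y \<partial>unif Y) \<le> e"
      using intE eventually_ge_at_top[of 1] eventually_ge_at_top[of y0]
    proof eventually_elim
      case (elim Y)
      \<comment> \<open>The middle range depends on \<open>Y\<close>, which is why the tail bound
        has to be uniform in both the set and \<open>Y\<close>.\<close>
      define A where "A = {n. 2 ^ J < lam n \<and> lam n \<le> XX Y}"
      define h2 where "h2 y = 4 powr p * norm (exp_sum lam r A y) powr p" for y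
      define h3 where "h3 y = 2 powr p * (indicator {y0..Y} y *\<^sub>R \<bar>E y (XX Y)\<bar> powr p)" for y
      have A: "finite A"
        by (rule finite_subset[OF _ fin[of "XX Y"]]) (auto simp: A_def)
      have Y: "Y > 0"
        using elim by simp
      have supp: "h1 y = 0" "h3 y = 0" if "y \<notin> {0..Y}" for y
        using that elim y0 by (auto simp: h1_def h3_def split: split_indicator)
      have i1: "integrable (unif Y) h1" "(\<integral>y. h1 y \<partial>unif Y) = 1 / Y * c"
        using unif_supported[OF int1 supp(1) Y] by (simp_all add: c_def)
      have i2: "integrable (unif Y) h2" "(\<integral>y. h2 y \<partial>unif Y) \<le> 4 powr p * (K * q ^ J)"
        using integrable_unif_exp_sum_powr[OF A Y, of p lam r] tail[rule_format, OF J(2) A, of Y] elim p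
        unfolding h2_def A_def by simp_all
      have int3: "integrable lebesgue h3"
        using elim unfolding h3_def set_integrable_def by (intro integrable_mult_right)
      have "(\<integral>y. h3 y \<partial>lebesgue) = 2 powr p * (LINT y:{y0..Y}|lebesgue. \<bar>E y (XX Y)\<bar> powr p)"
        unfolding h3_def set_lebesgue_integral_def by (rule integral_mult_right_zero)
      then have i3: "integrable (unif Y) h3"
        "(\<integral>y. h3 y \<partial>unif Y) = 1 / Y * (2 powr p * (LINT y:{y0..Y}|lebesgue. \<bar>E y (XX Y)\<bar> powr p))"
        using unif_supported[OF int3 supp(2) Y] by simp_all
      have int: "integrable (unif Y) (\<lambda>y. h1 y + h2 y + h3 y)"
        using i1 i2 i3 by (intro Bochner_Integration.integrable_add)
      have nonneg: "h1 y \<ge> 0" "h2 y \<ge> 0" "h3 y \<ge> 0" for y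
        by (auto simp: h1_def h2_def h3_def)
      have le: "?d y \<le> h1 y + h2 y + h3 y" if y: "0 \<le> y" "y \<le> Y" for y
      proof (cases "y \<le> y0")
        case True
        then have "?d y = h1 y"
          using y by (simp add: h1_def)
        then show ?thesis
          using nonneg[of y] by linarith
      next
        case False
        have un: "{n. 0 < lam n \<and> lam n \<le> XX Y} = A0 \<union> A"
          using elim lam0 by (auto simp: A0_def A_def)
        have "(\<Sum>n | 0 < lam n \<and> lam n \<le> XX Y. r n * exp (\<i> * complex_of_real (lam n * y)))
            = exp_sum lam r A0 y + exp_sum lam r A y"
          unfolding un exp_sum_def using A A0 by (intro sum.union_disjoint) (auto simp: A0_def A_def)
        then have "\<phi> y - P y = 2 * Re (exp_sum lam r A y) + E y (XX Y)"
          using rep[of y "XX Y"] False elim by (simp add: P_def)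
        then have "\<bar>?f y - P y\<bar> \<le> 2 * norm (exp_sum lam r A y) + \<bar>E y (XX Y)\<bar>"
          using abs_Re_le_cmod[of "exp_sum lam r A y"] y by simp
        then have "?d y \<le> (2 * norm (exp_sum lam r A y) + \<bar>E y (XX Y)\<bar>) powr p"
          using p by (intro powr_mono2) auto
        also have "\<dots> \<le> 2 powr p * ((2 * norm (exp_sum lam r A y)) powr p + \<bar>E y (XX Y)\<bar> powr p)"
          using p by (intro powr_add_le_2) auto
        also have "\<dots> = h2 y + h3 y"
          using False y powr_mult[of 2 2 p] by (simp add: h2_def h3_def powr_mult distrib_left)
        finally show ?thesis
          using nonneg[of y] by linarith
      qed
      \<comment> \<open>The pointwise bound holds on \<open>[0, Y]\<close> only, and this interval
        carries all of \<open>unif Y\<close>.\<close>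
      have AE: "AE y in unif Y. 0 \<le> y \<and> y \<le> Y"
        unfolding unif_def
        by (subst AE_density) (auto intro!: AE_I2 measurable_compose[OF borel_measurable_unif_density] split: split_indicator_asm)
      have AE_le: "AE y in unif Y. ?d y \<le> h1 y + h2 y + h3 y"
        using AE by eventually_elim (rule le, simp_all)
      have int_d: "integrable (unif Y) ?d"
      proof (rule Bochner_Integration.integrable_bound[OF int])
        show "AE y in unif Y. norm (?d y) \<le> norm (h1 y + h2 y + h3 y)"
          using AE_le by eventually_elim simp
        show "?d \<in> borel_measurable (unif Y)"
          using d_meas by (subst measurable_cong_sets[OF sets_unif refl])
      qed
      have "(\<integral>y. ?d y \<partial>unif Y) \<le> (\<integral>y. h1 y + h2 y + h3 y \<partial>unif Y)"
        by (rule integral_mono_AE[OF int_d int AE_le])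
      also have "\<dots> = (\<integral>y. h1 y \<partial>unif Y) + (\<integral>y. h2 y \<partial>unif Y) + (\<integral>y. h3 y \<partial>unif Y)"
        using i1 i2 i3 by simp
      also have "\<dots> \<le> e / 4 + e / 2 + e / 4"
        using i1(2) i2(2) i3(2) J(1) elim by (intro add_mono) (auto simp: mult_ac)
      finally show ?case
        using int_d by simp
    qed
    with trigP show "\<exists>P. trig_poly (\<lambda>y. complex_of_real (P y)) \<and>
        (\<forall>\<^sub>F Y in at_top. integrable (unif Y) (\<lambda>y. \<bar>?f y - P y\<bar> powr p) \<and>
           (\<integral>y. \<bar>?f y - P y\<bar> powr p \<partial>unif Y) \<le> e)"
      by blast
  qed
qed

section \<open>Return from the cut-off function to \<open>\<phi>\<close>\<close>

lemma mean_eq_integral_unif: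
  fixes g \<phi> :: "real \<Rightarrow> real"
  assumes "(\<lambda>y. g (indicator {0..} y * \<phi> y)) \<in> borel_measurable lebesgue"
  shows "\<forall>\<^sub>F Y in at_top. (\<integral>y. g (indicator {0..} y * \<phi> y) \<partial>unif Y) = 1 / Y * (LINT y:{0..Y}|lebesgue. g (\<phi> y))"
  using eventually_gt_at_top[of "0::real"]
proof eventually_elim
  case (elim Y)
  have "(LINT y:{0..Y}|lebesgue. g (indicator {0..} y * \<phi> y)) = (LINT y:{0..Y}|lebesgue. g (\<phi> y))"
    by (rule set_lebesgue_integral_cong) auto
  then show ?case
    using integral_unif[OF assms elim] by simp
qed

lemma tendsto_mean_iff_unif:
  fixes g \<phi> :: "real \<Rightarrow> real"
  assumes "(\<lambda>y. g (indicator {0..} y * \<phi> y)) \<in> borel_measurable lebesgue"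
  shows "((\<lambda>Y. 1 / Y * (LINT y:{0..Y}|lebesgue. g (\<phi> y))) \<longlongrightarrow> L) at_top \<longleftrightarrow>
    ((\<lambda>Y. \<integral>y. g (indicator {0..} y * \<phi> y) \<partial>unif Y) \<longlongrightarrow> L) at_top"
proof (rule tendsto_cong)
  show "\<forall>\<^sub>F Y in at_top. 1 / Y * (LINT y:{0..Y}|lebesgue. g (\<phi> y)) = (\<integral>y. g (indicator {0..} y * \<phi> y) \<partial>unif Y)"
    using mean_eq_integral_unif[OF assms] by eventually_elim (rule sym)
qed

theorem corollary1p14:
  fixes p \<beta> :: real and \<phi> :: "real \<Rightarrow> real"
  assumes "p \<ge> 2"
    and "\<beta> > 1 - 1 / (2 * p + 4)"
    and "p_beta_function p \<beta> \<phi>"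
  shows "(\<exists>\<mu>. limiting_distribution \<phi> \<mu>) \<and>
    (\<forall>\<mu>. limiting_distribution \<phi> \<mu> \<longrightarrow>
      (\<forall>n :: nat. 1 \<le> n \<and> real n \<le> p \<longrightarrow>
        (\<forall>Y \<ge> 0. set_integrable lebesgue {0..Y} (\<lambda>y. \<phi> y ^ n)) \<and>
        integrable \<mu> (\<lambda>x. x ^ n) \<and>
        ((\<lambda>Y. 1 / Y * (LINT y:{0..Y}|lebesgue. \<phi> y ^ n)) \<longlongrightarrow> (LINT x|\<mu>. x ^ n)) at_top))"
proof -
  let ?f = "\<lambda>y. indicator {0..} y * \<phi> y"
  \<comment> \<open>Through this inequality the hypothesis gives \<open>\<beta> > 1 - 1 / p\<close>,
    which is what the decay over blocks uses.\<close>
  have "1 / (2 * p + 4) \<le> 1 / p"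
    using assms(1) by (intro divide_left_mono) auto
  then have f: "besicovitch_ap p ?f"
    using assms by (intro p_beta_function_besicovitch_ap[of p \<beta>]) auto
  then have [measurable]: "?f \<in> borel_measurable lebesgue"
    by (rule besicovitch_ap_measurable)
  have mean: "((\<lambda>Y. 1 / Y * (LINT y:{0..Y}|lebesgue. g (\<phi> y))) \<longlongrightarrow> L) at_top \<longleftrightarrow>
      ((\<lambda>Y. \<integral>y. g (?f y) \<partial>unif Y) \<longlongrightarrow> L) at_top" if "continuous_on UNIV g" for g :: "real \<Rightarrow> real" and L
  proof -
    have [measurable]: "g \<in> borel_measurable borel"
      using that by (rule borel_measurable_continuous_onI)
    show ?thesis
      by (rule tendsto_mean_iff_unif) measurable
  qed
  \<comment> \<open>Stated for arbitrary \<open>\<mu>\<close>, so that the moment argument applies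
    to every limiting distribution and not just to the one constructed.\<close>
  have lim_iff: "limiting_distribution \<phi> \<mu> \<longleftrightarrow> real_distribution \<mu> \<and>
      (\<forall>g :: real \<Rightarrow> real. continuous_on UNIV g \<longrightarrow> bounded (range g) \<longrightarrow>
        ((\<lambda>Y. \<integral>y. g (?f y) \<partial>unif Y) \<longlongrightarrow> (\<integral>x. g x \<partial>\<mu>)) at_top)" for \<mu>
    unfolding limiting_distribution_def using mean by blast
  have "\<exists>\<mu>. limiting_distribution \<phi> \<mu>"
  proof -
    have "besicovitch_ap 1 ?f"
      using f assms(1) by (intro besicovitch_ap_1[of p]) auto
    then obtain \<mu> where "real_distribution \<mu>"
      "\<And>g :: real \<Rightarrow> real. continuous_on UNIV g \<Longrightarrow> bounded (range g) \<Longrightarrow>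
         ((\<lambda>Y. \<integral>y. g (?f y) \<partial>unif Y) \<longlongrightarrow> (\<integral>x. g x \<partial>\<mu>)) at_top"
      by (rule besicovitch_ap_weak_limit) (rule that)
    then show ?thesis
      unfolding lim_iff by blast
  qed
  moreover have "set_integrable lebesgue {0..Y} (\<lambda>y. \<phi> y ^ n)" if "real n \<le> p" for n Y
  proof -
    \<comment> \<open>Integrability is known for large intervals only, so \<open>[0, Y]\<close> is
      placed inside a larger \<open>[0, Z]\<close>.\<close>
    have "\<forall>\<^sub>F Z in at_top. integrable (unif Z) (\<lambda>y. ?f y ^ n) \<and> max 1 Y \<le> Z"
      using besicovitch_ap_power_integrable[OF f that] eventually_ge_at_top by (rule eventually_conj)
    then obtain Z where "integrable (unif Z) (\<lambda>y. ?f y ^ n)" "Z > 0" "Y \<le> Z"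
      by (auto simp: eventually_at_top_linorder)
    then have "set_integrable lebesgue {0..Y} (\<lambda>y. ?f y ^ n)"
      by (subst (asm) integrable_unif) (auto intro: set_integrable_subset)
    then show ?thesis
      by (rule set_integrable_cong[THEN iffD1, rotated -1]) auto
  qed
  moreover have "integrable \<mu> (\<lambda>x. x ^ n)"
    "((\<lambda>Y. 1 / Y * (LINT y:{0..Y}|lebesgue. \<phi> y ^ n)) \<longlongrightarrow> (LINT x|\<mu>. x ^ n)) at_top"
    if "limiting_distribution \<phi> \<mu>" "real n \<le> p" for \<mu> n
  proof -
    have \<mu>: "real_distribution \<mu>"
      and lim: "\<And>g :: real \<Rightarrow> real. continuous_on UNIV g \<Longrightarrow> bounded (range g) \<Longrightarrow>
        ((\<lambda>Y. \<integral>y. g (?f y) \<partial>unif Y) \<longlongrightarrow> (\<integral>x. g x \<partial>\<mu>)) at_top"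
      using that(1) by (simp_all add: lim_iff)
    show "integrable \<mu> (\<lambda>x. x ^ n)"
      using f that(2) \<mu> lim by (rule besicovitch_ap_moments(1))
    have "((\<lambda>Y. \<integral>y. ?f y ^ n \<partial>unif Y) \<longlongrightarrow> (\<integral>x. x ^ n \<partial>\<mu>)) at_top"
      using f that(2) \<mu> lim by (rule besicovitch_ap_moments(2))
    then show "((\<lambda>Y. 1 / Y * (LINT y:{0..Y}|lebesgue. \<phi> y ^ n)) \<longlongrightarrow> (LINT x|\<mu>. x ^ n)) at_top"
      by (subst mean[of "\<lambda>x. x ^ n"]) (intro continuous_intros)
  qed
  ultimately show ?thesis
    by blast
qed

end
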